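(* Let $\mathbb{G}$ be a stratified Lie group of homogeneous dimension $Q$. Let $s\in(0,1)$, $p\in(1,\infty)$ with $Q>ps$, and let $q$ satisfy $p\le q<p_s^*:=\frac{Qp}{Q-ps}$. Let $(u_k)$ be a bounded sequence in $W_0^{s,p}(\mathbb{G})$ such that $$\liminf_{k\to\infty}\ \sup_{x\in\mathbb{G}}\int_{B(x,1)}|u_k|^q\,dy=0.$$ Then there exists a subsequence, also denoted by $(u_k)$, such that $u_k\to0$ in $L^t(\mathbb{G})$ for every $t\in(q,p_s^* )$.
   Context: Stratified Lie group: a Lie group $\mathbb{G}=(\mathbb{R}^N,\circ)$ with a decomposition $\mathbb{R}^N=\mathbb{R}^{N_1}\times\cdots\times\mathbb{R}^{N_k}$ such that (i) for each $\lambda>0$ the dilation $D_\lambda(x)=(\lambda x^{(1)},\lambda^2x^{(2)},\dots,\lambda^kx^{(k)})$, $x^{(i)}\in\mathbb{R}^{N_i}$, is an automorphism of $\mathbb{G}$; (ii) if $X_1,\dots,X_{N_1}$ are the left-invariant vector fields with $X_j(0)=\partial/\partial x_j|_0$, then the Lie algebra they generate has rank $N$ at every point. Its homogeneous dimension is $Q=\sum_{i=1}^k iN_i$. Haar measure $dx$ is Lebesgue measure on $\mathbb{R}^N$. $|\cdot|:\mathbb{G}\to[0,\infty)$ is a fixed homogeneous quasi-norm: continuous, $|x|=0$ iff $x=0$, $|x^{-1}|=|x|$, $|D_\lambda x|=\lambda|x|$ for $\lambda>0$. Quasi-balls: $B(x,r)=\{y\in\mathbb{G}:|y^{-1}\circ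 x|<r\}$. $W^{s,p}(\mathbb{G})=\{u\in L^p(\mathbb{G}):[u]_{s,p}<\infty\}$, with $[u]_{s,p}^p=\iint_{\mathbb{G}\times\mathbb{G}}\frac{|u(x)-u(y)|^p}{|y^{-1}x|^{Q+ps}}dxdy$ and norm $\|u\|_{W^{s,p}}^p=\|u\|_{L^p}^p+[u]_{s,p}^p$; $W_0^{s,p}(\mathbb{G})$ is the closure of $C_c^\infty(\mathbb{G})$ in this norm (it equals $W^{s,p}(\mathbb{G})$). *)

theory Defs
  imports "HOL-Analysis.Analysis" "HOL-Algebra.Group"
begin

section \<open>Smooth functions and vector fields on Euclidean space\<close>

primrec Ck :: "nat \<Rightarrow> ('a::euclidean_space \<Rightarrow> 'b::euclidean_space) \<Rightarrow> bool" where
  "Ck 0 f \<longleftrightarrow> continuous_on UNIV f"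
| "Ck (Suc m) f \<longleftrightarrow> (\<forall>x. f differentiable at x) \<and>
     (\<forall>v. Ck m (\<lambda>x. frechet_derivative f (at x) v))"

definition smooth :: "('a::euclidean_space \<Rightarrow> 'b::euclidean_space) \<Rightarrow> bool" where
  "smooth f \<longleftrightarrow> (\<forall>m. Ck m f)"

definition Cc_infinity :: "('a::euclidean_space \<Rightarrow> real) set" where
  "Cc_infinity = {f. smooth f \<and> compact (closure (support_on UNIV f))}"

text \<open>A vector field \<open>\<Sum>\<^sub>j X\<^sub>j \<partial>\<^sub>j\<close> is represented by its coefficient map \<open>X\<close>;
  the bracket is the commutator of the corresponding differential operators.\<close>

definition lie_bracket ::
    "('a::euclidean_space \<Rightarrow> 'a) \<Rightarrow> ('a \<Rightarrow> 'a) \<Rightarrow> ('a \<Rightarrow> 'a)" where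
  "lie_bracket X Y =
     (\<lambda>x. frechet_derivative Y (at x) (X x) - frechet_derivative X (at x) (Y x))"

inductive_set lie_algebra_generated ::
    "('a::euclidean_space \<Rightarrow> 'a) set \<Rightarrow> ('a \<Rightarrow> 'a) set" for S where
  generator: "X \<in> S \<Longrightarrow> X \<in> lie_algebra_generated S"
| zero: "(\<lambda>x. 0) \<in> lie_algebra_generated S"
| add: "X \<in> lie_algebra_generated S \<Longrightarrow> Y \<in> lie_algebra_generated S \<Longrightarrow>
     (\<lambda>x. X x + Y x) \<in> lie_algebra_generated S"
| scale: "X \<in> lie_algebra_generated S \<Longrightarrow> (\<lambda>x. c *\<^sub>R X x) \<in> lie_algebra_generated S"
| bracket: "X \<in> lie_algebra_generated S \<Longrightarrow> Y \<in> lie_algebra_generated S \<Longrightarrow>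
     lie_bracket X Y \<in> lie_algebra_generated S"


section \<open>Stratified Lie groups\<close>

text \<open>The splitting of \<open>\<real>\<^sup>N\<close> into \<open>\<real>\<^bsup>N\<^sub>1\<^esup> \<times> \<dots> \<times> \<real>\<^bsup>N\<^sub>k\<^esup>\<close>
  is encoded by a weight function \<open>w\<close> on the coordinate indices: coordinate \<open>i\<close> belongs to the
  factor number \<open>w i\<close>, so that \<open>N\<^sub>j = card {i. w i = j}\<close>.\<close>

definition dilation :: "('n::finite \<Rightarrow> nat) \<Rightarrow> real \<Rightarrow> real^'n \<Rightarrow> real^'n" where
  "dilation w c x = (\<chi> i. c ^ w i * x $ i)"

definition homogeneous_dim :: "('n::finite \<Rightarrow> nat) \<Rightarrow> nat \<Rightarrow> nat" where
  "homogeneous_dim w k = (\<Sum>j=1..k. j * card {i. w i = j})"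

text \<open>Left invariance: \<open>d(L\<^sub>x)\<^sub>y (X y) = X (x \<circ> y)\<close> for all left translations \<open>L\<^sub>x\<close>.\<close>

definition left_invariant :: "(real^'n::finite) monoid \<Rightarrow> (real^'n \<Rightarrow> real^'n) \<Rightarrow> bool" where
  "left_invariant G X \<longleftrightarrow>
     (\<forall>x y. frechet_derivative (\<lambda>z. x \<otimes>\<^bsub>G\<^esub> z) (at y) (X y) = X (x \<otimes>\<^bsub>G\<^esub> y))"

definition first_layer_fields ::
    "(real^'n::finite) monoid \<Rightarrow> ('n \<Rightarrow> nat) \<Rightarrow> (real^'n \<Rightarrow> real^'n) set" where
  "first_layer_fields G w =
     {X. left_invariant G X \<and> (\<exists>i. w i = 1 \<and> X 0 = axis i 1)}"

locale stratified_Lie_group = group G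
  for G :: "(real^'n::finite) monoid" (structure) +
  fixes w :: "'n \<Rightarrow> nat" and k :: nat
  assumes carrier_UNIV: "carrier G = UNIV"
    and smooth_mult: "smooth (\<lambda>(x, y). x \<otimes> y)"
    and smooth_inv: "smooth (\<lambda>x. inv x)"
    and layers: "range w = {1..k}"
    and dilation_automorphism: "\<And>c. c > 0 \<Longrightarrow> dilation w c \<in> iso G G"
    and full_rank: "\<And>x. dim {Z x | Z. Z \<in> lie_algebra_generated (first_layer_fields G w)}
                          = CARD('n)"

definition homogeneous_quasi_norm ::
    "(real^'n::finite) monoid \<Rightarrow> ('n \<Rightarrow> nat) \<Rightarrow> (real^'n \<Rightarrow> real) \<Rightarrow> bool" where
  "homogeneous_quasi_norm G w nrm \<longleftrightarrow>
     continuous_on UNIV nrm \<and> (\<forall>x. nrm x \<ge> 0) \<and> (\<forall>x. nrm x = 0 \<longleftrightarrow> x = 0) \<and>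
     (\<forall>x. nrm (inv\<^bsub>G\<^esub> x) = nrm x) \<and>
     (\<forall>c x. c > 0 \<longrightarrow> nrm (dilation w c x) = c * nrm x)"

definition quasi_ball ::
    "(real^'n::finite) monoid \<Rightarrow> (real^'n \<Rightarrow> real) \<Rightarrow> real^'n \<Rightarrow> real \<Rightarrow> (real^'n) set" where
  "quasi_ball G nrm x r = {y. nrm (inv\<^bsub>G\<^esub> y \<otimes>\<^bsub>G\<^esub> x) < r}"


section \<open>Lebesgue and fractional Sobolev spaces\<close>

text \<open>Norms take values in \<open>[0, \<infinity>]\<close>; they are the \<open>p\<close>-th roots of the integrals below.\<close>

definition ennreal_root :: "real \<Rightarrow> ennreal \<Rightarrow> ennreal" where
  "ennreal_root p a = (if a = \<infinity> then \<infinity> else ennreal (enn2real a powr (1 / p)))"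

definition Lp_integral :: "real \<Rightarrow> ('a::euclidean_space \<Rightarrow> real) \<Rightarrow> ennreal" where
  "Lp_integral p u = (\<integral>\<^sup>+ x. ennreal (\<bar>u x\<bar> powr p) \<partial>lebesgue)"

definition Lp_norm :: "real \<Rightarrow> ('a::euclidean_space \<Rightarrow> real) \<Rightarrow> ennreal" where
  "Lp_norm p u = ennreal_root p (Lp_integral p u)"

definition Lp_space :: "real \<Rightarrow> ('a::euclidean_space \<Rightarrow> real) set" where
  "Lp_space p = {u. u \<in> borel_measurable lebesgue \<and> Lp_integral p u < \<infinity>}"

text \<open>The \<open>p\<close>-th power of the Gagliardo seminorm; \<open>Q\<close> is the homogeneous dimension. On the
  diagonal, a null set, the integrand is \<open>0 / 0 = 0\<close>.\<close>

definition gagliardo_integral ::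
    "(real^'n::finite) monoid \<Rightarrow> (real^'n \<Rightarrow> real) \<Rightarrow> real \<Rightarrow> real \<Rightarrow> real \<Rightarrow>
     (real^'n \<Rightarrow> real) \<Rightarrow> ennreal" where
  "gagliardo_integral G nrm Q s p u =
     (\<integral>\<^sup>+ (x, y). ennreal (\<bar>u x - u y\<bar> powr p / nrm (inv\<^bsub>G\<^esub> y \<otimes>\<^bsub>G\<^esub> x) powr (Q + p * s))
        \<partial>(lebesgue \<Otimes>\<^sub>M lebesgue))"

definition Wsp_space ::
    "(real^'n::finite) monoid \<Rightarrow> (real^'n \<Rightarrow> real) \<Rightarrow> real \<Rightarrow> real \<Rightarrow> real \<Rightarrow>
     (real^'n \<Rightarrow> real) set" where
  "Wsp_space G nrm Q s p = {u. u \<in> Lp_space p \<and> gagliardo_integral G nrm Q s p u < \<infinity>}"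

definition Wsp_norm ::
    "(real^'n::finite) monoid \<Rightarrow> (real^'n \<Rightarrow> real) \<Rightarrow> real \<Rightarrow> real \<Rightarrow> real \<Rightarrow>
     (real^'n \<Rightarrow> real) \<Rightarrow> ennreal" where
  "Wsp_norm G nrm Q s p u =
     ennreal_root p (Lp_integral p u + gagliardo_integral G nrm Q s p u)"

definition W0sp_space ::
    "(real^'n::finite) monoid \<Rightarrow> (real^'n \<Rightarrow> real) \<Rightarrow> real \<Rightarrow> real \<Rightarrow> real \<Rightarrow>
     (real^'n \<Rightarrow> real) set" where
  "W0sp_space G nrm Q s p =
     {u \<in> Wsp_space G nrm Q s p.
        \<forall>\<epsilon>>0. \<exists>\<phi>\<in>Cc_infinity. Wsp_norm G nrm Q s p (\<lambda>x. u x - \<phi> x) < ennreal \<epsilon>}"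

end

theory Submission
  imports Defs
begin

text \<open>Fix \<open>x\<close> with \<open>u x \<noteq> 0\<close>. Choosing the radius \<open>r\<close> of a ball around \<open>x\<close> so that, by Chebyshev and a bound
  \<open>I\<close> on the local \<open>L\<^sup>a\<close> mass, \<open>\<bar>u\<bar> \<ge> \<bar>u x\<bar> / 2\<close> on at most half of it, the Gagliardo energy density \<open>g\<close>
  at \<open>x\<close> controls \<open>\<bar>u x\<bar>\<close>; optimising gives the pointwise inequality
  \<open>\<bar>u x\<bar> powr (p + a p s / Q) \<le> C I powr (p s / Q) g x\<close>. With the global mass this is a Sobolev
  step from \<open>L\<^sup>a\<close> to exponent \<open>p + a p s / Q\<close>, whose iterates converge to the critical
  exponent; with the mass on unit balls it turns vanishing into convergence in one space
  \<open>L\<^sup>b\<close>, which the iteration and interpolation with \<open>L\<^sup>p\<close> spread to the whole range. The only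
  geometric input is \<open>\<bar>B(x, r)\<bar> \<ge> c r powr Q\<close>: left translations by elements of a compact set
  are uniformly Lipschitz on compact sets, and dilations reduce every ball to that case.\<close>

section \<open>Convergence to zero and interpolation\<close>

lemma tendsto_0_ennreal_iff:
  fixes f :: "'a \<Rightarrow> ennreal"
  shows "(f \<longlongrightarrow> 0) F \<longleftrightarrow> (\<forall>e>0. \<forall>\<^sub>F x in F. f x \<le> ennreal e)"
proof
  assume f: "(f \<longlongrightarrow> 0) F"
  show "\<forall>e>0. \<forall>\<^sub>F x in F. f x \<le> ennreal e"
  proof (intro allI impI)
    fix e :: real assume "0 < e"
    then have "\<forall>\<^sub>F x in F. f x < ennreal e"
      by (intro order_tendstoD(2)[OF f]) simp
    then show "\<forall>\<^sub>F x in F. f x \<le> ennreal e"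
      by eventually_elim simp
  qed
next
  assume f: "\<forall>e>0. \<forall>\<^sub>F x in F. f x \<le> ennreal e"
  show "(f \<longlongrightarrow> 0) F"
  proof (rule order_tendstoI)
    fix a :: ennreal assume "0 < a"
    then obtain b where b: "0 < b" "b < a" using dense by blast
    then obtain e where e: "b = ennreal e" "0 \<le> e" by (cases b) auto
    with b have "\<forall>\<^sub>F x in F. f x \<le> ennreal e"
      using f by (auto simp: less_le)
    then show "\<forall>\<^sub>F x in F. f x < a"
      by eventually_elim (use b e in auto)
  qed simp
qed

text \<open>Turns an estimate at an arbitrary level \<open>I\<close> into a limit. The level is a
  positive real above \<open>f x\<close>, not \<open>f x\<close> itself, because the radius built
  from it below must be positive and finite.\<close>

lemma tendsto_0_ennreal_power_bound:
  fixes f g :: "'a \<Rightarrow> ennreal"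
  assumes f: "(f \<longlongrightarrow> 0) F" and "0 \<le> K" "0 < \<theta>"
    and bound: "\<And>x I. 0 < I \<Longrightarrow> f x \<le> ennreal I \<Longrightarrow> g x \<le> ennreal (K * I powr \<theta>)"
  shows "(g \<longlongrightarrow> 0) F"
  unfolding tendsto_0_ennreal_iff
proof (intro allI impI)
  fix e :: real assume "0 < e"
  \<comment> \<open>Solves \<open>(K + 1) * I powr \<theta> = e\<close>; the \<open>+ 1\<close>
    covers \<open>K = 0\<close>.\<close>
  define I where "I = (e / (K + 1)) powr (1 / \<theta>)"
  have I: "0 < I" "I powr \<theta> = e / (K + 1)"
    using assms \<open>0 < e\<close> by (auto simp: I_def powr_powr)
  have "K * I powr \<theta> \<le> e"
    using assms \<open>0 < e\<close> unfolding I by (simp add: field_simps)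
  moreover have "\<forall>\<^sub>F x in F. f x \<le> ennreal I"
    using f I by (simp add: tendsto_0_ennreal_iff)
  ultimately show "\<forall>\<^sub>F x in F. g x \<le> ennreal e"
    by (elim eventually_mono) (use bound[OF I(1)] ennreal_leI order_trans in blast)
qed

text \<open>Below the threshold \<open>\<delta>\<close> the first summand dominates, above it the
  second. Since \<open>\<delta>\<close> is free, for \<open>p < t\<close> the coefficient of the
  power \<open>p\<close> can be made small at the expense of the other one.\<close>

lemma powr_interpolate:
  fixes p t b \<delta> y :: real
  assumes "p \<le> t" "t \<le> b" "0 < \<delta>" "0 \<le> y"
  shows "y powr t \<le> \<delta> powr (t - p) * y powr p + \<delta> powr (t - b) * y powr b"
proof (cases "y = 0")
  case False
  then have y: "0 < y" using assms by simp
  show ?thesis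
  proof (cases "y \<le> \<delta>")
    case True
    have "y powr t = y powr (t - p) * y powr p"
      using y by (simp flip: powr_add)
    also have "\<dots> \<le> \<delta> powr (t - p) * y powr p"
      using True assms y by (intro mult_right_mono powr_mono2) auto
    finally show ?thesis by (simp add: add_increasing2)
  next
    case False
    have "y powr t = y powr (t - b) * y powr b"
      using y by (simp flip: powr_add)
    also have "\<dots> \<le> \<delta> powr (t - b) * y powr b"
      using False assms y by (intro mult_right_mono powr_mono2') auto
    finally show ?thesis by (simp add: add_increasing)
  qed
qed simp

lemma nn_integral_powr_interpolate:
  fixes u :: "'a \<Rightarrow> real"
  assumes [measurable]: "u \<in> borel_measurable M"
    and "p \<le> t" "t \<le> b" "0 < \<delta>"
  shows "(\<integral>\<^sup>+ x. ennreal (\<bar>u x\<bar> powr t) \<partial>M)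
    \<le> ennreal (\<delta> powr (t - p)) * (\<integral>\<^sup>+ x. ennreal (\<bar>u x\<bar> powr p) \<partial>M)
      + ennreal (\<delta> powr (t - b)) * (\<integral>\<^sup>+ x. ennreal (\<bar>u x\<bar> powr b) \<partial>M)"
proof -
  have "(\<integral>\<^sup>+ x. ennreal (\<bar>u x\<bar> powr t) \<partial>M)
    \<le> (\<integral>\<^sup>+ x. ennreal (\<delta> powr (t - p)) * ennreal (\<bar>u x\<bar> powr p)
               + ennreal (\<delta> powr (t - b)) * ennreal (\<bar>u x\<bar> powr b) \<partial>M)"
    using powr_interpolate[OF assms(2-4)]
    by (intro nn_integral_mono) (simp add: ennreal_leI flip: ennreal_mult ennreal_plus)
  then show ?thesis
    by (simp add: nn_integral_add nn_integral_cmult)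
qed

section \<open>Fractional Sobolev inequalities over lower regular kernels\<close>

text \<open>Abstracts the quasi-distance \<open>|y^{-1} x|\<close>. The volume bound asks for some
  measurable set inside the ball, so a convenient subset can serve as witness. In what follows
  \<open>\<sigma>\<close> stands for \<open>p * s\<close>.\<close>

locale lower_regular_kernel = sigma_finite_measure M for M :: "'a measure" +
  fixes N :: "'a \<Rightarrow> 'a \<Rightarrow> real" and Q c :: real
  assumes measurable_N [measurable]: "(\<lambda>(x, y). N x y) \<in> borel_measurable (M \<Otimes>\<^sub>M M)"
    and N_nonneg: "0 \<le> N x y"
    and N_eq_0: "N x y = 0 \<Longrightarrow> x = y"
    and Q_pos: "0 < Q" and c_pos: "0 < c"
    and lower_regular: "x \<in> space M \<Longrightarrow> 0 < r \<Longrightarrow>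
      \<exists>S\<in>sets M. (\<forall>y\<in>S. N x y < r) \<and> ennreal (c * r powr Q) \<le> emeasure M S"
begin

section \<open>Gagliardo energy and the pointwise Hedberg estimate\<close>

definition energy :: "real \<Rightarrow> real \<Rightarrow> ('a \<Rightarrow> real) \<Rightarrow> ennreal" where
  "energy p \<sigma> u =
    (\<integral>\<^sup>+ (x, y). ennreal (\<bar>u x - u y\<bar> powr p / N x y powr (Q + \<sigma>)) \<partial>(M \<Otimes>\<^sub>M M))"

definition energy_density :: "real \<Rightarrow> real \<Rightarrow> ('a \<Rightarrow> real) \<Rightarrow> 'a \<Rightarrow> ennreal" where
  "energy_density p \<sigma> u x = (\<integral>\<^sup>+ y. ennreal (\<bar>u x - u y\<bar> powr p / N x y powr (Q + \<sigma>)) \<partial>M)"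

lemma measurable_energy_density [measurable]:
  assumes [measurable]: "u \<in> borel_measurable M"
  shows "energy_density p \<sigma> u \<in> borel_measurable M"
  unfolding energy_density_def by measurable

lemma nn_integral_energy_density:
  assumes [measurable]: "u \<in> borel_measurable M"
  shows "(\<integral>\<^sup>+ x. energy_density p \<sigma> u x \<partial>M) = energy p \<sigma> u"
  unfolding energy_def energy_density_def
  by (subst nn_integral_fst[symmetric]) (auto simp: case_prod_beta)

text \<open>Solves \<open>c * r powr Q = 2 * I / (\<tau> / 2) powr a\<close>: the guaranteed volume
  is twice the Chebyshev bound for the set where
  \<open>\<bar>u\<bar> \<ge> \<tau> / 2\<close>.\<close>

definition hedberg_radius :: "real \<Rightarrow> real \<Rightarrow> real \<Rightarrow> real" where
  "hedberg_radius a I \<tau> = (2 powr (a + 1) * I / (c * \<tau> powr a)) powr (1 / Q)"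

text \<open>The first factor comes from absorbing half of the volume and from the lower bound
  \<open>\<tau> / 2\<close>; the second is the part of \<open>(r powr Q) powr (\<sigma> / Q)\<close>
  free of \<open>I\<close> and \<open>\<tau>\<close>.\<close>

definition hedberg_const :: "real \<Rightarrow> real \<Rightarrow> real \<Rightarrow> real" where
  "hedberg_const p \<sigma> a = 2 powr (p + 1) / c * (2 powr (a + 1) / c) powr (\<sigma> / Q)"

lemma hedberg_const_nonneg: "0 \<le> hedberg_const p \<sigma> a"
  using c_pos by (simp add: hedberg_const_def)

text \<open>For \<open>y \<in> S\<close> either \<open>\<bar>u y\<bar>\<close> or \<open>\<bar>u x - u y\<bar>\<close> is at least \<open>\<bar>u x\<bar> / 2\<close>. The Hedberg radius is
  the one for which, by Chebyshev, the first alternative fills at most half of \<open>S\<close>.\<close>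

lemma hedberg_pointwise:
  fixes u :: "'a \<Rightarrow> real"
  assumes [measurable]: "u \<in> borel_measurable M" "S \<in> sets M" and x: "x \<in> space M" "u x \<noteq> 0"
    and pos: "0 < p" "0 < a" "0 < \<sigma>" "0 < I"
    and r_def: "r = hedberg_radius a I \<bar>u x\<bar>"
    and near: "\<And>y. y \<in> S \<Longrightarrow> N x y < r"
    and large: "ennreal (c * r powr Q) \<le> emeasure M S"
    and I: "(\<integral>\<^sup>+ y\<in>S. ennreal (\<bar>u y\<bar> powr a) \<partial>M) \<le> ennreal I"
  shows "ennreal (\<bar>u x\<bar> powr (p + a * \<sigma> / Q))
    \<le> ennreal (hedberg_const p \<sigma> a * I powr (\<sigma> / Q)) * energy_density p \<sigma> u x"
proof (cases "energy_density p \<sigma> u x")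
  case top
  \<comment> \<open>An infinite density makes the right-hand side infinite once its coefficient is
    positive.\<close>
  have "0 < hedberg_const p \<sigma> a"
    using c_pos by (simp add: hedberg_const_def)
  then show ?thesis unfolding top using pos by (simp add: ennreal_mult_top)
next
  case (real g)
  define \<tau> where "\<tau> = \<bar>u x\<bar>"
  have \<tau>: "0 < \<tau>" using x by (simp add: \<tau>_def)
  \<comment> \<open>Normalised by its lower bound \<open>\<tau> / 2\<close>, each alternative
    contributes at least 1; \<open>B\<close> also pays for replacing \<open>N x y\<close> by the
    larger \<open>r\<close>.\<close>
  define A where "A = (2 / \<tau>) powr a"
  define B where "B = (2 / \<tau>) powr p * r powr (Q + \<sigma>)"
  have AB: "0 \<le> A" "0 \<le> B" by (auto simp: A_def B_def)
  have r: "0 < r" "r powr Q = 2 powr (a + 1) * I / (c * \<tau> powr a)"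
    using \<tau> c_pos pos Q_pos by (auto simp: r_def hedberg_radius_def \<tau>_def powr_powr)
  have [measurable]: "(\<lambda>y. N x y) \<in> borel_measurable M"
    using measurable_compose_Pair1[OF x(1) measurable_N] by simp
  define h where "h = (\<lambda>y. \<bar>u x - u y\<bar> powr p / N x y powr (Q + \<sigma>))"
  have hM [measurable]: "h \<in> borel_measurable M" unfolding h_def by measurable
  have h0: "0 \<le> h y" for y by (simp add: h_def)
  have diff: "\<bar>u x - u y\<bar> powr p \<le> r powr (Q + \<sigma>) * h y" if "y \<in> S" for y
  proof (cases "N x y = 0")
    \<comment> \<open>Here \<open>h y = 0\<close> by division by zero, and the left side vanishes as
      well because \<open>x = y\<close>.\<close>
    case True
    then show ?thesis using N_eq_0[of x y] by (simp add: h_def)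
  next
    case False
    then have Npos: "0 < N x y" using N_nonneg[of x y] by simp
    have "\<bar>u x - u y\<bar> powr p = N x y powr (Q + \<sigma>) * h y"
      using Npos by (simp add: h_def)
    also have "\<dots> \<le> r powr (Q + \<sigma>) * h y"
      using near[OF that] Npos Q_pos pos h0 by (intro mult_right_mono powr_mono2) auto
    finally show ?thesis .
  qed
  have split: "1 \<le> A * \<bar>u y\<bar> powr a + B * h y" if "y \<in> S" for y
  proof -
    have "\<tau> / 2 \<le> \<bar>u y\<bar> \<or> \<tau> / 2 \<le> \<bar>u x - u y\<bar>"
      unfolding \<tau>_def by arith
    then show ?thesis
    proof
      assume *: "\<tau> / 2 \<le> \<bar>u y\<bar>"
      have "1 \<le> (2 / \<tau> * \<bar>u y\<bar>) powr a"
        using * \<tau> pos by (intro ge_one_powr_ge_zero) (auto simp: field_simps)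
      also have "\<dots> = A * \<bar>u y\<bar> powr a"
        using \<tau> by (subst powr_mult) (simp_all add: A_def)
      finally show ?thesis using AB h0[of y] by (simp add: add_increasing2)
    next
      assume *: "\<tau> / 2 \<le> \<bar>u x - u y\<bar>"
      have "1 \<le> (2 / \<tau> * \<bar>u x - u y\<bar>) powr p"
        using * \<tau> pos by (intro ge_one_powr_ge_zero) (auto simp: field_simps)
      also have "\<dots> = (2 / \<tau>) powr p * \<bar>u x - u y\<bar> powr p"
        using \<tau> by (subst powr_mult) simp_all
      also have "\<dots> \<le> (2 / \<tau>) powr p * (r powr (Q + \<sigma>) * h y)"
        using diff[OF that] by (intro mult_left_mono) auto
      finally have "1 \<le> B * h y" by (simp add: B_def mult.assoc)
      then show ?thesis using AB by (simp add: add_increasing)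
    qed
  qed
  \<comment> \<open>Integrate \<open>split\<close> over \<open>S\<close>; the second term is
    enlarged to the whole space, which produces the density \<open>g\<close>.\<close>
  have "ennreal (c * r powr Q) \<le> (\<integral>\<^sup>+ y. indicator S y \<partial>M)"
    using large by simp
  also have "\<dots> \<le> (\<integral>\<^sup>+ y. ennreal A * (ennreal (\<bar>u y\<bar> powr a) * indicator S y)
                     + ennreal B * ennreal (h y) \<partial>M)"
  proof (rule nn_integral_mono)
    fix y
    have "(1::ennreal) \<le> ennreal A * ennreal (\<bar>u y\<bar> powr a) + ennreal B * ennreal (h y)"
      if "y \<in> S"
    proof -
      have "(1::ennreal) \<le> ennreal (A * \<bar>u y\<bar> powr a + B * h y)"
        using ennreal_leI[OF split[OF that]] by simp
      then show ?thesis using AB h0 by (simp add: ennreal_mult ennreal_plus)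
    qed
    then show "indicator S y \<le> ennreal A * (ennreal (\<bar>u y\<bar> powr a) * indicator S y)
                     + ennreal B * ennreal (h y)"
      by (auto simp: indicator_def)
  qed
  also have "\<dots> = ennreal A * (\<integral>\<^sup>+ y\<in>S. ennreal (\<bar>u y\<bar> powr a) \<partial>M) + ennreal B * ennreal g"
    using real by (simp add: nn_integral_add nn_integral_cmult energy_density_def h_def)
  also have "\<dots> \<le> ennreal A * ennreal I + ennreal B * ennreal g"
    by (intro add_mono mult_left_mono I) auto
  also have "\<dots> = ennreal (A * I + B * g)"
    using AB pos real by (simp add: ennreal_mult ennreal_plus)
  finally have "c * r powr Q \<le> A * I + B * g"
    using AB pos real by (subst (asm) ennreal_le_iff) auto
  \<comment> \<open>The purpose of the radius: the mass term is exactly half of the volume term, so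
    it is absorbed on the left.\<close>
  moreover have "2 * (A * I) = c * r powr Q"
    using \<tau> c_pos unfolding r A_def by (simp add: powr_divide powr_add field_simps)
  ultimately have "c * r powr Q \<le> 2 * (2 / \<tau>) powr p * g * r powr \<sigma> * r powr Q"
    by (simp add: B_def powr_add mult_ac)
  then have "c \<le> 2 * (2 / \<tau>) powr p * g * r powr \<sigma>"
    using r(1) by simp
  also have "\<dots> = 2 powr (p + 1) * g * r powr \<sigma> / \<tau> powr p"
    by (simp add: powr_divide powr_add)
  finally have "c * \<tau> powr p \<le> 2 powr (p + 1) * g * r powr \<sigma>"
    using \<tau> by (simp add: pos_le_divide_eq)
  then have main: "\<tau> powr p \<le> 2 powr (p + 1) / c * g * r powr \<sigma>"
    using c_pos by (simp add: field_simps)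
  \<comment> \<open>Expressing \<open>r powr \<sigma>\<close> through \<open>r powr Q\<close>
    exposes the denominator \<open>\<tau> powr (a * \<sigma> / Q)\<close>; moved to the left, it
    raises the exponent above \<open>p\<close>.\<close>
  have "r powr \<sigma> = (r powr Q) powr (\<sigma> / Q)"
    using Q_pos by (simp add: powr_powr)
  also have "\<dots> = (2 powr (a + 1) / c) powr (\<sigma> / Q) * I powr (\<sigma> / Q) / \<tau> powr (a * \<sigma> / Q)"
    unfolding r using c_pos pos \<tau> by (simp add: powr_divide powr_mult powr_powr)
  finally have r\<sigma>: "r powr \<sigma> * \<tau> powr (a * \<sigma> / Q)
      = (2 powr (a + 1) / c) powr (\<sigma> / Q) * I powr (\<sigma> / Q)"
    using \<tau> by simp
  have "\<tau> powr (p + a * \<sigma> / Q) \<le> (2 powr (p + 1) / c * g * r powr \<sigma>) * \<tau> powr (a * \<sigma> / Q)"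
    unfolding powr_add[of \<tau>] by (intro mult_right_mono main) auto
  also have "\<dots> = 2 powr (p + 1) / c * g * (r powr \<sigma> * \<tau> powr (a * \<sigma> / Q))"
    by (simp add: mult_ac)
  also have "\<dots> = hedberg_const p \<sigma> a * I powr (\<sigma> / Q) * g"
    unfolding r\<sigma> hedberg_const_def by (simp add: mult_ac)
  finally have "ennreal (\<tau> powr (p + a * \<sigma> / Q))
      \<le> ennreal (hedberg_const p \<sigma> a * I powr (\<sigma> / Q) * g)"
    by (rule ennreal_leI)
  then show ?thesis
    unfolding real using real hedberg_const_nonneg by (simp add: ennreal_mult \<tau>_def)
qed

text \<open>The global mass bounds the mass on every ball, so the pointwise estimate holds
  everywhere with one constant and can be integrated.\<close>

lemma sobolev_step:
  fixes u :: "'a \<Rightarrow> real"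
  assumes u [measurable]: "u \<in> borel_measurable M"
    and pos: "0 < p" "0 < a" "0 < \<sigma>" "0 < I"
    and I: "(\<integral>\<^sup>+ y. ennreal (\<bar>u y\<bar> powr a) \<partial>M) \<le> ennreal I"
  shows "(\<integral>\<^sup>+ y. ennreal (\<bar>u y\<bar> powr (p + a * \<sigma> / Q)) \<partial>M)
    \<le> ennreal (hedberg_const p \<sigma> a * I powr (\<sigma> / Q)) * energy p \<sigma> u"
proof -
  have "ennreal (\<bar>u x\<bar> powr (p + a * \<sigma> / Q))
    \<le> ennreal (hedberg_const p \<sigma> a * I powr (\<sigma> / Q)) * energy_density p \<sigma> u x"
    if x: "x \<in> space M" for x
  proof (cases "u x = 0")
    case False
    define r where "r = hedberg_radius a I \<bar>u x\<bar>"
    have "0 < r" using False c_pos pos by (simp add: r_def hedberg_radius_def)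
    from lower_regular[OF x this] obtain S where S: "S \<in> sets M" "\<And>y. y \<in> S \<Longrightarrow> N x y < r"
      "ennreal (c * r powr Q) \<le> emeasure M S" by blast
    have "(\<integral>\<^sup>+ y\<in>S. ennreal (\<bar>u y\<bar> powr a) \<partial>M) \<le> (\<integral>\<^sup>+ y. ennreal (\<bar>u y\<bar> powr a) \<partial>M)"
      by (intro nn_integral_mono) (auto simp: indicator_def)
    then have "(\<integral>\<^sup>+ y\<in>S. ennreal (\<bar>u y\<bar> powr a) \<partial>M) \<le> ennreal I"
      using I by (rule order_trans)
    then show ?thesis
      using S by (intro hedberg_pointwise[OF u S(1) x False pos r_def]) auto
  qed simp
  then have "(\<integral>\<^sup>+ y. ennreal (\<bar>u y\<bar> powr (p + a * \<sigma> / Q)) \<partial>M)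
    \<le> (\<integral>\<^sup>+ y. ennreal (hedberg_const p \<sigma> a * I powr (\<sigma> / Q)) * energy_density p \<sigma> u y \<partial>M)"
    by (intro nn_integral_mono)
  then show ?thesis
    by (simp add: nn_integral_cmult nn_integral_energy_density)
qed

text \<open>With mass controlled on unit balls only, the Hedberg radius must not exceed 1. It can do
  so only where \<open>\<bar>u x\<bar> powr a\<close> is at most
  \<open>2 powr (a + 1) * I / c\<close>; there the excess power \<open>a * \<sigma> / Q\<close> is
  bounded by that level, leaving a multiple of \<open>\<bar>u x\<bar> powr p\<close>.\<close>

lemma vanishing_step:
  fixes u :: "'a \<Rightarrow> real"
  assumes u [measurable]: "u \<in> borel_measurable M"
    and pos: "0 < p" "0 < a" "0 < \<sigma>" "0 < I"
    and I: "\<And>x. x \<in> space M \<Longrightarrow> (\<integral>\<^sup>+ y\<in>{y. N x y < 1}. ennreal (\<bar>u y\<bar> powr a) \<partial>M) \<le> ennreal I"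
  shows "(\<integral>\<^sup>+ y. ennreal (\<bar>u y\<bar> powr (p + a * \<sigma> / Q)) \<partial>M)
    \<le> ennreal (hedberg_const p \<sigma> a * I powr (\<sigma> / Q)) * energy p \<sigma> u
      + ennreal ((2 powr (a + 1) * I / c) powr (\<sigma> / Q)) * (\<integral>\<^sup>+ y. ennreal (\<bar>u y\<bar> powr p) \<partial>M)"
proof -
  have "ennreal (\<bar>u x\<bar> powr (p + a * \<sigma> / Q))
    \<le> ennreal (hedberg_const p \<sigma> a * I powr (\<sigma> / Q)) * energy_density p \<sigma> u x
      + ennreal ((2 powr (a + 1) * I / c) powr (\<sigma> / Q)) * ennreal (\<bar>u x\<bar> powr p)"
    if x: "x \<in> space M" for x
  proof (cases "u x = 0")
    case False
    define r where "r = hedberg_radius a I \<bar>u x\<bar>"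
    have r: "0 < r" using False c_pos pos by (simp add: r_def hedberg_radius_def)
    show ?thesis
    proof (cases "\<bar>u x\<bar> powr a \<le> 2 powr (a + 1) * I / c")
      case True
      have "\<bar>u x\<bar> powr (p + a * \<sigma> / Q) = (\<bar>u x\<bar> powr a) powr (\<sigma> / Q) * \<bar>u x\<bar> powr p"
        by (simp add: powr_powr powr_add mult_ac)
      also have "\<dots> \<le> (2 powr (a + 1) * I / c) powr (\<sigma> / Q) * \<bar>u x\<bar> powr p"
        using True pos Q_pos by (intro mult_right_mono powr_mono2) auto
      finally have "ennreal (\<bar>u x\<bar> powr (p + a * \<sigma> / Q))
          \<le> ennreal ((2 powr (a + 1) * I / c) powr (\<sigma> / Q)) * ennreal (\<bar>u x\<bar> powr p)"
        by (simp add: ennreal_leI flip: ennreal_mult)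
      then show ?thesis by (simp add: add_increasing)
    next
      case big: False
      have "2 powr (a + 1) * I / (c * \<bar>u x\<bar> powr a) \<le> 1"
        using big c_pos False by (simp add: field_simps)
      then have r1: "r \<le> 1"
        unfolding r_def hedberg_radius_def using c_pos pos Q_pos by (intro powr_le1) auto
      from lower_regular[OF x r] obtain S where S: "S \<in> sets M" "\<And>y. y \<in> S \<Longrightarrow> N x y < r"
        "ennreal (c * r powr Q) \<le> emeasure M S" by blast
      have "(\<integral>\<^sup>+ y\<in>S. ennreal (\<bar>u y\<bar> powr a) \<partial>M)
          \<le> (\<integral>\<^sup>+ y\<in>{y. N x y < 1}. ennreal (\<bar>u y\<bar> powr a) \<partial>M)"
        using S(2) r1 by (intro nn_integral_mono) (fastforce simp: indicator_def)
      then have "(\<integral>\<^sup>+ y\<in>S. ennreal (\<bar>u y\<bar> powr a) \<partial>M) \<le> ennreal I"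
        using I[OF x] by (rule order_trans)
      then have "ennreal (\<bar>u x\<bar> powr (p + a * \<sigma> / Q))
        \<le> ennreal (hedberg_const p \<sigma> a * I powr (\<sigma> / Q)) * energy_density p \<sigma> u x"
        using S by (intro hedberg_pointwise[OF u S(1) x False pos r_def]) auto
      then show ?thesis by (simp add: add_increasing2)
    qed
  qed simp
  then have "(\<integral>\<^sup>+ y. ennreal (\<bar>u y\<bar> powr (p + a * \<sigma> / Q)) \<partial>M)
    \<le> (\<integral>\<^sup>+ x. ennreal (hedberg_const p \<sigma> a * I powr (\<sigma> / Q)) * energy_density p \<sigma> u x
      + ennreal ((2 powr (a + 1) * I / c) powr (\<sigma> / Q)) * ennreal (\<bar>u x\<bar> powr p) \<partial>M)"
    by (intro nn_integral_mono)
  then show ?thesis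
    by (simp add: nn_integral_add nn_integral_cmult nn_integral_energy_density)
qed

section \<open>Iteration of the exponents up to the critical one\<close>

abbreviation next_exponent :: "real \<Rightarrow> real \<Rightarrow> real \<Rightarrow> real" where
  "next_exponent p \<sigma> a \<equiv> p + a * \<sigma> / Q"

text \<open>The map is affine with slope \<open>\<sigma> / Q < 1\<close>, so the distance to its
  fixed point shrinks geometrically from any start. For \<open>\<sigma> = p * s\<close> the fixed
  point is the critical exponent.\<close>

lemma next_exponent_iterate_tendsto:
  assumes "0 < \<sigma>" "\<sigma> < Q"
  shows "(\<lambda>n. (next_exponent p \<sigma> ^^ n) a) \<longlonglongrightarrow> Q * p / (Q - \<sigma>)"
proof -
  define L where "L = Q * p / (Q - \<sigma>)"
  have L: "p + L * \<sigma> / Q = L"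
    using assms by (simp add: L_def field_simps)
  have "(next_exponent p \<sigma> ^^ n) a = L - (L - a) * (\<sigma> / Q) ^ n" for n
  proof (induction n)
    case (Suc n)
    have "(next_exponent p \<sigma> ^^ Suc n) a = p + (L - (L - a) * (\<sigma> / Q) ^ n) * \<sigma> / Q"
      by (simp only: funpow.simps comp_apply Suc.IH)
    also have "\<dots> = (p + L * \<sigma> / Q) - (L - a) * (\<sigma> / Q) ^ Suc n"
      using Q_pos by (simp add: field_simps)
    finally show ?case unfolding L .
  qed simp
  moreover have "(\<lambda>n. L - (L - a) * (\<sigma> / Q) ^ n) \<longlonglongrightarrow> L - (L - a) * 0"
    using assms by (intro tendsto_intros LIMSEQ_realpow_zero) auto
  ultimately show ?thesis by (simp add: L_def)
qed

lemma next_exponent_iterate_exceeds: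
  assumes "0 < \<sigma>" "\<sigma> < Q" "t < Q * p / (Q - \<sigma>)"
  shows "\<exists>n. t < (next_exponent p \<sigma> ^^ n) a"
  using eventually_happens'[OF _ order_tendstoD(1)[OF next_exponent_iterate_tendsto[OF assms(1,2)] assms(3)]]
  by simp

lemma next_exponent_iterate_pos:
  assumes "0 < p" "0 < a" "0 < \<sigma>"
  shows "0 < (next_exponent p \<sigma> ^^ n) a"
  using assms Q_pos by (induction n) (auto intro!: add_pos_pos)

text \<open>Bootstrap: \<open>sobolev_step\<close> carries finiteness along the iterates of
  \<open>p\<close>, some iterate exceeds \<open>t\<close>, and interpolation between
  \<open>p\<close> and that iterate reaches \<open>t\<close>.\<close>

lemma subcritical_integral_finite:
  fixes u :: "'a \<Rightarrow> real"
  assumes u [measurable]: "u \<in> borel_measurable M"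
    and "0 < p" "0 < \<sigma>" "\<sigma> < Q" "p \<le> t" "t < Q * p / (Q - \<sigma>)"
    and fin: "(\<integral>\<^sup>+ x. ennreal (\<bar>u x\<bar> powr p) \<partial>M) < \<infinity>" "energy p \<sigma> u < \<infinity>"
  shows "(\<integral>\<^sup>+ x. ennreal (\<bar>u x\<bar> powr t) \<partial>M) < \<infinity>"
proof -
  have *: "(\<integral>\<^sup>+ x. ennreal (\<bar>u x\<bar> powr ((next_exponent p \<sigma> ^^ n) p)) \<partial>M) < \<infinity>" for n
  proof (induction n)
    case 0
    then show ?case using fin by simp
  next
    case (Suc n)
    define a where "a = (next_exponent p \<sigma> ^^ n) p"
    have a: "0 < a" unfolding a_def using assms by (intro next_exponent_iterate_pos) auto
    from Suc.IH obtain J where J: "(\<integral>\<^sup>+ x. ennreal (\<bar>u x\<bar> powr a) \<partial>M) = ennreal J" "0 \<le> J"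
      unfolding a_def by (cases "\<integral>\<^sup>+ x. ennreal (\<bar>u x\<bar> powr ((next_exponent p \<sigma> ^^ n) p)) \<partial>M") auto
    \<comment> \<open>\<open>J\<close> may be 0, whereas \<open>sobolev_step\<close> asks for a
      positive bound.\<close>
    have "(\<integral>\<^sup>+ x. ennreal (\<bar>u x\<bar> powr a) \<partial>M) \<le> ennreal (J + 1)"
      unfolding J by (simp add: ennreal_leI)
    then have "(\<integral>\<^sup>+ x. ennreal (\<bar>u x\<bar> powr (next_exponent p \<sigma> a)) \<partial>M)
        \<le> ennreal (hedberg_const p \<sigma> a * (J + 1) powr (\<sigma> / Q)) * energy p \<sigma> u"
      using J a assms by (intro sobolev_step) auto
    also have "\<dots> < \<infinity>" using fin by (simp add: ennreal_mult_less_top)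
    finally show ?case by (simp add: a_def)
  qed
  obtain n where n: "t < (next_exponent p \<sigma> ^^ n) p"
    using next_exponent_iterate_exceeds assms by blast
  have "(\<integral>\<^sup>+ x. ennreal (\<bar>u x\<bar> powr t) \<partial>M)
    \<le> ennreal (1 powr (t - p)) * (\<integral>\<^sup>+ x. ennreal (\<bar>u x\<bar> powr p) \<partial>M)
      + ennreal (1 powr (t - (next_exponent p \<sigma> ^^ n) p)) *
        (\<integral>\<^sup>+ x. ennreal (\<bar>u x\<bar> powr ((next_exponent p \<sigma> ^^ n) p)) \<partial>M)"
    using assms n by (intro nn_integral_powr_interpolate) auto
  also have "\<dots> < \<infinity>" using * fin by simp
  finally show ?thesis .
qed

text \<open>Smallness propagates along the iterates of \<open>b\<close>, one of which exceeds
  \<open>t\<close> wherever \<open>b\<close> lies. Interpolation with the bounded mass at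
  \<open>p\<close> brings it down to \<open>t\<close>; \<open>p < t\<close> allows the coefficient
  of that mass to be made small.\<close>

lemma subcritical_integral_tendsto_0:
  fixes v :: "'b \<Rightarrow> 'a \<Rightarrow> real"
  assumes v [measurable]: "\<And>m. v m \<in> borel_measurable M"
    and p: "0 < p" "0 < \<sigma>" "\<sigma> < Q" "p < t" "t < Q * p / (Q - \<sigma>)" "0 < b" "0 \<le> E"
    and bound: "\<And>m. (\<integral>\<^sup>+ x. ennreal (\<bar>v m x\<bar> powr p) \<partial>M) \<le> ennreal E"
      "\<And>m. energy p \<sigma> (v m) \<le> ennreal E"
    and lim: "((\<lambda>m. \<integral>\<^sup>+ x. ennreal (\<bar>v m x\<bar> powr b) \<partial>M) \<longlongrightarrow> 0) F"
  shows "((\<lambda>m. \<integral>\<^sup>+ x. ennreal (\<bar>v m x\<bar> powr t) \<partial>M) \<longlongrightarrow> 0) F"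
proof -
  have *: "((\<lambda>m. \<integral>\<^sup>+ x. ennreal (\<bar>v m x\<bar> powr ((next_exponent p \<sigma> ^^ n) b)) \<partial>M) \<longlongrightarrow> 0) F" for n
  proof (induction n)
    case 0
    then show ?case using lim by simp
  next
    case (Suc n)
    define a where "a = (next_exponent p \<sigma> ^^ n) b"
    have a: "0 < a" unfolding a_def using p by (intro next_exponent_iterate_pos) auto
    have "((\<lambda>m. \<integral>\<^sup>+ x. ennreal (\<bar>v m x\<bar> powr next_exponent p \<sigma> a) \<partial>M) \<longlongrightarrow> 0) F"
    proof (rule tendsto_0_ennreal_power_bound[OF Suc.IH[folded a_def]])
      fix m I assume I: "0 < (I::real)" "(\<integral>\<^sup>+ x. ennreal (\<bar>v m x\<bar> powr a) \<partial>M) \<le> ennreal I"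
      have "(\<integral>\<^sup>+ x. ennreal (\<bar>v m x\<bar> powr next_exponent p \<sigma> a) \<partial>M)
        \<le> ennreal (hedberg_const p \<sigma> a * I powr (\<sigma> / Q)) * energy p \<sigma> (v m)"
        using p a I by (intro sobolev_step) auto
      also have "\<dots> \<le> ennreal (hedberg_const p \<sigma> a * I powr (\<sigma> / Q)) * ennreal E"
        by (intro mult_left_mono bound) auto
      also have "\<dots> = ennreal (hedberg_const p \<sigma> a * E * I powr (\<sigma> / Q))"
        using p hedberg_const_nonneg by (simp add: mult_ac flip: ennreal_mult)
      finally show "(\<integral>\<^sup>+ x. ennreal (\<bar>v m x\<bar> powr next_exponent p \<sigma> a) \<partial>M)
        \<le> ennreal (hedberg_const p \<sigma> a * E * I powr (\<sigma> / Q))" .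
    qed (use p hedberg_const_nonneg in auto)
    then show ?case by (simp add: a_def)
  qed
  obtain n where n: "t < (next_exponent p \<sigma> ^^ n) b"
    using next_exponent_iterate_exceeds p by blast
  define d where "d = (next_exponent p \<sigma> ^^ n) b"
  show ?thesis
    unfolding tendsto_0_ennreal_iff
  proof (intro allI impI)
    fix e :: real assume e: "0 < e"
    \<comment> \<open>Makes the \<open>p\<close> term at most \<open>e / 2\<close>;
      \<open>E + 1\<close> covers \<open>E = 0\<close>.\<close>
    define \<delta> where "\<delta> = (e / (2 * (E + 1))) powr (1 / (t - p))"
    have \<delta>: "0 < \<delta>" "\<delta> powr (t - p) = e / (2 * (E + 1))"
      using e p by (auto simp: \<delta>_def powr_powr)
    \<comment> \<open>The factor \<open>\<delta> powr (d - t)\<close> cancels the coefficient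
      \<open>\<delta> powr (t - d)\<close> of this integral, leaving \<open>e / 2\<close>.\<close>
    have "\<forall>\<^sub>F m in F. (\<integral>\<^sup>+ x. ennreal (\<bar>v m x\<bar> powr d) \<partial>M) \<le> ennreal (\<delta> powr (d - t) * e / 2)"
      using *[of n] e \<delta> by (auto simp: d_def tendsto_0_ennreal_iff)
    then show "\<forall>\<^sub>F m in F. (\<integral>\<^sup>+ x. ennreal (\<bar>v m x\<bar> powr t) \<partial>M) \<le> ennreal e"
    proof eventually_elim
      case (elim m)
      have "(\<integral>\<^sup>+ x. ennreal (\<bar>v m x\<bar> powr t) \<partial>M)
        \<le> ennreal (\<delta> powr (t - p)) * (\<integral>\<^sup>+ x. ennreal (\<bar>v m x\<bar> powr p) \<partial>M)
          + ennreal (\<delta> powr (t - d)) * (\<integral>\<^sup>+ x. ennreal (\<bar>v m x\<bar> powr d) \<partial>M)"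
        using p n \<delta> by (intro nn_integral_powr_interpolate) (auto simp: d_def)
      also have "\<dots> \<le> ennreal (\<delta> powr (t - p)) * ennreal E
          + ennreal (\<delta> powr (t - d)) * ennreal (\<delta> powr (d - t) * e / 2)"
        by (intro add_mono mult_left_mono bound elim) auto
      also have "\<dots> = ennreal (\<delta> powr (t - p) * E + \<delta> powr (t - d) * (\<delta> powr (d - t) * e / 2))"
        using p e by (simp flip: ennreal_mult ennreal_plus)
      also have "\<delta> powr (t - d) * (\<delta> powr (d - t) * e / 2) = e / 2"
        using \<delta> by (simp flip: powr_add mult.assoc)
      also have "\<delta> powr (t - p) * E + e / 2 \<le> e"
        unfolding \<delta> using e p by (simp add: field_simps)
      finally show ?case by (simp add: ennreal_leI)
    qed
  qed
qed

text \<open>By \<open>vanishing_step\<close>, vanishing on unit balls gives convergence at the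
  single exponent \<open>next_exponent p \<sigma> q\<close>; the previous lemma transfers it to
  \<open>t\<close>.\<close>

theorem vanishing:
  fixes v :: "'b \<Rightarrow> 'a \<Rightarrow> real"
  assumes v [measurable]: "\<And>m. v m \<in> borel_measurable M"
    and p: "0 < p" "0 < \<sigma>" "\<sigma> < Q" "p < t" "t < Q * p / (Q - \<sigma>)" "0 < q" "0 \<le> E"
    and bound: "\<And>m. (\<integral>\<^sup>+ x. ennreal (\<bar>v m x\<bar> powr p) \<partial>M) \<le> ennreal E"
      "\<And>m. energy p \<sigma> (v m) \<le> ennreal E"
    and lim: "((\<lambda>m. SUP x\<in>space M. \<integral>\<^sup>+ y\<in>{y. N x y < 1}. ennreal (\<bar>v m y\<bar> powr q) \<partial>M) \<longlongrightarrow> 0) F"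
  shows "((\<lambda>m. \<integral>\<^sup>+ x. ennreal (\<bar>v m x\<bar> powr t) \<partial>M) \<longlongrightarrow> 0) F"
proof (rule subcritical_integral_tendsto_0[OF v p(1-5) _ p(7) bound])
  show "0 < next_exponent p \<sigma> q"
    using p Q_pos by (auto intro!: add_pos_pos)
  \<comment> \<open>Both terms of \<open>vanishing_step\<close> scale like
    \<open>I powr (\<sigma> / Q)\<close>; \<open>K\<close> collects the remaining factors.\<close>
  define K where "K = (hedberg_const p \<sigma> q + (2 powr (q + 1) / c) powr (\<sigma> / Q)) * E"
  show "((\<lambda>m. \<integral>\<^sup>+ x. ennreal (\<bar>v m x\<bar> powr next_exponent p \<sigma> q) \<partial>M) \<longlongrightarrow> 0) F"
  proof (rule tendsto_0_ennreal_power_bound[OF lim])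
    fix m I
    assume I: "0 < (I::real)"
      "(SUP x\<in>space M. \<integral>\<^sup>+ y\<in>{y. N x y < 1}. ennreal (\<bar>v m y\<bar> powr q) \<partial>M) \<le> ennreal I"
    then have "(\<integral>\<^sup>+ x. ennreal (\<bar>v m x\<bar> powr next_exponent p \<sigma> q) \<partial>M)
      \<le> ennreal (hedberg_const p \<sigma> q * I powr (\<sigma> / Q)) * energy p \<sigma> (v m)
        + ennreal ((2 powr (q + 1) * I / c) powr (\<sigma> / Q)) * (\<integral>\<^sup>+ y. ennreal (\<bar>v m y\<bar> powr p) \<partial>M)"
      using p by (intro vanishing_step) (auto simp: SUP_le_iff)
    also have "\<dots> \<le> ennreal (hedberg_const p \<sigma> q * I powr (\<sigma> / Q)) * ennreal E
        + ennreal ((2 powr (q + 1) * I / c) powr (\<sigma> / Q)) * ennreal E"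
      by (intro add_mono mult_left_mono bound) auto
    also have "\<dots> = ennreal (hedberg_const p \<sigma> q * I powr (\<sigma> / Q) * E
        + (2 powr (q + 1) * I / c) powr (\<sigma> / Q) * E)"
      using p hedberg_const_nonneg by (simp flip: ennreal_mult ennreal_plus)
    also have "(2 powr (q + 1) * I / c) powr (\<sigma> / Q)
        = (2 powr (q + 1) / c) powr (\<sigma> / Q) * I powr (\<sigma> / Q)"
      using I c_pos by (simp flip: powr_mult)
    finally show "(\<integral>\<^sup>+ x. ennreal (\<bar>v m x\<bar> powr next_exponent p \<sigma> q) \<partial>M)
        \<le> ennreal (K * I powr (\<sigma> / Q))"
      by (simp add: K_def algebra_simps)
  qed (use p Q_pos hedberg_const_nonneg in \<open>auto simp: K_def\<close>)
qed

end

section \<open>Volume of quasi-balls\<close>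

lemma sigma_finite_lebesgue: "sigma_finite_measure (lebesgue :: 'a::euclidean_space measure)"
proof
  show "\<exists>A::'a set set. countable A \<and> A \<subseteq> sets lebesgue \<and> \<Union> A = space lebesgue
      \<and> (\<forall>a\<in>A. emeasure lebesgue a \<noteq> \<infinity>)"
  proof (intro exI[of _ "range (\<lambda>n. cball 0 (real n))"] conjI)
    show "\<Union> (range (\<lambda>n. cball 0 (real n))) = space (lebesgue :: 'a measure)"
      using real_arch_simple by (force simp: space_completion)
    have "emeasure lborel (cball (0::'a) (real n)) \<noteq> \<infinity>" for n
      using emeasure_lborel_cball_finite[of "0::'a" "real n"] by auto
    then show "\<forall>a\<in>range (\<lambda>n. cball (0::'a) (real n)). emeasure lebesgue a \<noteq> \<infinity>"
      by auto
  qed auto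
qed

text \<open>A crude constant suffices below; unlike the library's change of variables, this covers
  index types that carry no order.\<close>

lemma measure_image_le_if_onorm_le:
  fixes f :: "'a::euclidean_space \<Rightarrow> 'a"
  assumes U: "open U" "bounded U"
    and der: "\<And>x. x \<in> U \<Longrightarrow> (f has_derivative f' x) (at x)"
    and C: "\<And>x. x \<in> U \<Longrightarrow> onorm (f' x) \<le> C" "0 \<le> C"
    and fU: "f ` U \<in> sets lebesgue"
  shows "measure lebesgue (f ` U) \<le> unit_ball_vol DIM('a) * (C * DIM('a)) ^ DIM('a) * measure lebesgue U"
proof (cases "U = {}")
  case False
  obtain B where B: "\<And>x. x \<in> U \<Longrightarrow> norm x \<le> B"
    using U(2) bounded_iff by blast
  then have B0: "0 \<le> B" using False norm_ge_zero order_trans by blast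
  define M where "M = unit_ball_vol DIM('a) * (C * DIM('a)) ^ DIM('a)"
  have M: "0 \<le> M" using C by (simp add: M_def)
  define c where "c = B + 1"
  have "U \<subseteq> cbox (- c *\<^sub>R One) (c *\<^sub>R One)"
  proof
    fix x assume "x \<in> U"
    then have "\<bar>x \<bullet> i\<bar> \<le> c" if "i \<in> Basis" for i
      using B[of x] Basis_le_norm[OF that, of x] by (simp add: c_def)
    then show "x \<in> cbox (- c *\<^sub>R One) (c *\<^sub>R One)"
      by (auto simp: mem_box abs_le_iff minus_le_iff)
  qed
  moreover have "box (- c *\<^sub>R One) (c *\<^sub>R One) \<noteq> ({}::'a set)"
    using B0 by (auto simp: box_ne_empty c_def)
  \<comment> \<open>Every dyadic cube of the covering has its tag in \<open>U\<close>, and this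
    gauge then keeps the cube inside \<open>U\<close>.\<close>
  moreover have "gauge (\<lambda>x. if x \<in> U then U else UNIV)"
    using U by (auto simp: gauge_def)
  ultimately obtain \<D> where D: "countable \<D>"
    "\<And>K. K \<in> \<D> \<Longrightarrow> interior K \<noteq> {} \<and> (\<exists>c d. K = cbox c d)"
    "pairwise (\<lambda>A B. interior A \<inter> interior B = {}) \<D>"
    "\<And>K. K \<in> \<D> \<Longrightarrow> \<exists>x \<in> U \<inter> K. K \<subseteq> (if x \<in> U then U else UNIV)"
    "\<And>u v. cbox u v \<in> \<D> \<Longrightarrow>
      \<exists>n. \<forall>i \<in> Basis. v \<bullet> i - u \<bullet> i = ((c *\<^sub>R One) \<bullet> i - (- c *\<^sub>R One) \<bullet> i) / 2 ^ n"
    "U \<subseteq> \<Union>\<D>"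
    by (rule covering_lemma) blast
  have KU: "K \<subseteq> U" if "K \<in> \<D>" for K
    using D(4)[OF that] by auto
  \<comment> \<open>On a cube of side \<open>l\<close> the mean value inequality confines the image
    to a ball of radius \<open>C * DIM('a) * l\<close>, whose volume is \<open>M\<close> times that
    of the cube. The dimension factor comes from bounding the norm by the sum of
    coordinates.\<close>
  have "\<exists>K'. K' \<in> lmeasurable \<and> f ` K \<subseteq> K' \<and> measure lebesgue K' \<le> M * measure lebesgue K"
    if K: "K \<in> \<D>" for K
  proof -
    from D(2)[OF K] obtain u v where uv: "K = cbox u v" by (elim conjE exE)
    have "cbox u v \<in> \<D>" by (rule K[unfolded uv])
    from D(5)[OF this] obtain n where n: "\<forall>i \<in> Basis. v \<bullet> i - u \<bullet> i = ((c *\<^sub>R One) \<bullet> i - (- c *\<^sub>R One) \<bullet> i) / 2 ^ n" ..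
    define l where "l = 2 * c / 2 ^ n"
    have l: "0 < l" "\<And>i. i \<in> Basis \<Longrightarrow> v \<bullet> i - u \<bullet> i = l"
    proof -
      show "0 < l" using B0 by (simp add: l_def c_def)
      fix i :: 'a assume i: "i \<in> Basis"
      have "v \<bullet> i - u \<bullet> i = ((c *\<^sub>R One) \<bullet> i - (- c *\<^sub>R One) \<bullet> i) / 2 ^ n"
        by (rule bspec[OF n i])
      also have "\<dots> = l"
        by (simp only: inner_scaleR_left inner_sum_Basis[OF i] l_def) simp
      finally show "v \<bullet> i - u \<bullet> i = l" .
    qed
    define L where "L = C * (DIM('a) * l)"
    have L: "0 \<le> L" using C l by (simp add: L_def)
    have "u \<bullet> i \<le> v \<bullet> i" if "i \<in> Basis" for i
      using l(1) l(2)[OF that] by linarith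
    then have uv_le: "\<forall>i\<in>Basis. u \<bullet> i \<le> v \<bullet> i" by blast
    have uK: "u \<in> K" using uv_le by (simp add: uv mem_box)
    have near: "norm (f y - f u) \<le> L" if y: "y \<in> K" for y
    proof -
      have "norm (f y - f u) \<le> C * norm (y - u)"
        using y uK KU[OF K] der C
        by (intro differentiable_bound[of K f f'])
           (auto simp: uv intro: has_derivative_at_withinI)
      also have "norm (y - u) \<le> (\<Sum>i\<in>Basis. \<bar>(y - u) \<bullet> i\<bar>)"
        by (rule norm_le_l1)
      also have "\<dots> \<le> (\<Sum>i\<in>(Basis::'a set). l)"
      proof (rule sum_mono)
        fix i :: 'a assume "i \<in> Basis"
        then show "\<bar>(y - u) \<bullet> i\<bar> \<le> l"
          using y l(2)[of i] by (auto simp: uv mem_box inner_diff_left)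
      qed
      finally show ?thesis using C by (simp add: L_def mult_left_mono)
    qed
    have "f ` K \<subseteq> cball (f u) L"
      using near by (auto simp: dist_norm norm_minus_commute)
    moreover have "measure lebesgue (cball (f u) L) = unit_ball_vol DIM('a) * L ^ DIM('a)"
      using L by (simp add: content_cball)
    moreover have "measure lebesgue K = l ^ DIM('a)"
    proof -
      have "measure lebesgue K = measure lborel (cbox u v)"
        by (simp add: uv)
      also have "\<dots> = (\<Prod>i\<in>Basis. v \<bullet> i - u \<bullet> i)"
        by (rule content_cbox[OF uv_le])
      also have "\<dots> = (\<Prod>i\<in>(Basis::'a set). l)"
        by (rule prod.cong[OF refl]) (rule l(2))
      finally show ?thesis by simp
    qed
    moreover have "unit_ball_vol DIM('a) * L ^ DIM('a) = M * l ^ DIM('a)"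
      by (simp add: M_def L_def mult.assoc flip: power_mult_distrib)
    ultimately show ?thesis
      by (intro exI[of _ "cball (f u) L"]) simp
  qed
  then have "\<forall>K\<in>\<D>. \<exists>K'. K' \<in> lmeasurable \<and> f ` K \<subseteq> K' \<and>
      measure lebesgue K' \<le> M * measure lebesgue K" ..
  from bchoice[OF this] obtain \<kappa> where "\<forall>K\<in>\<D>. \<kappa> K \<in> lmeasurable \<and> f ` K \<subseteq> \<kappa> K \<and>
      measure lebesgue (\<kappa> K) \<le> M * measure lebesgue K" ..
  then have \<kappa>: "\<And>K. K \<in> \<D> \<Longrightarrow> \<kappa> K \<in> lmeasurable" "\<And>K. K \<in> \<D> \<Longrightarrow> f ` K \<subseteq> \<kappa> K"
    "\<And>K. K \<in> \<D> \<Longrightarrow> measure lebesgue (\<kappa> K) \<le> M * measure lebesgue K"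
    by simp_all
  have Ulm: "U \<in> lmeasurable"
    by (rule lmeasurable_open[OF U(2,1)])
  have Dne: "\<D> \<noteq> {}"
  proof
    assume "\<D> = {}"
    then show False using D(6) False by simp
  qed
  \<comment> \<open>The enumeration repeats cubes if \<open>\<D>\<close> is finite. Unions are
    unaffected, and volumes are summed over the set \<open>E\<close>, where no cube counts
    twice.\<close>
  define S where "S = (\<lambda>n. \<kappa> (from_nat_into \<D> n))"
  have S: "S n \<in> lmeasurable" for n
    unfolding S_def by (rule \<kappa>(1)[OF from_nat_into[OF Dne]])
  have bound: "measure lebesgue (\<Union>i\<le>n. S i) \<le> M * measure lebesgue U" for n
  proof -
    define E where "E = from_nat_into \<D> ` {..n}"
    have E: "finite E" "E \<subseteq> \<D>"
      using from_nat_into[OF Dne] by (auto simp: E_def)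
    have "(\<Union>i\<le>n. S i) = (\<Union>K\<in>E. \<kappa> K)"
      by (auto simp: S_def E_def)
    then have "measure lebesgue (\<Union>i\<le>n. S i) \<le> (\<Sum>K\<in>E. measure lebesgue (\<kappa> K))"
      using E \<kappa>(1) by (auto intro!: measure_UNION_le fmeasurableD)
    also have "\<dots> \<le> (\<Sum>K\<in>E. M * measure lebesgue K)"
      using E \<kappa>(3) by (intro sum_mono) auto
    also have "\<dots> = M * measure lebesgue (\<Union>E)"
    proof -
      \<comment> \<open>The intersection is convex with empty interior, hence null, so the volumes
        of distinct cubes add up.\<close>
      have "negligible (A \<inter> B)" if AB: "A \<in> \<D>" "B \<in> \<D>" "A \<noteq> B" for A B
      proof -
        have "negligible (frontier (A \<inter> B))"
          using D(2)[OF AB(1)] D(2)[OF AB(2)] by (auto intro!: negligible_convex_frontier convex_Int)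
        moreover have "interior (A \<inter> B) = {}"
          using D(3) AB by (simp add: pairwise_def)
        ultimately show ?thesis
          by (metis Diff_empty closure_subset frontier_def negligible_subset)
      qed
      then have "measure lebesgue (\<Union>E) = (\<Sum>K\<in>E. measure lebesgue K)"
        using E D(2) by (intro measure_negligible_finite_Union) (auto simp: pairwise_def)
      then show ?thesis by (simp add: sum_distrib_left)
    qed
    also have "\<dots> \<le> M * measure lebesgue U"
    proof (intro mult_left_mono measure_mono_fmeasurable Ulm M)
      show "\<Union>E \<subseteq> U" using E(2) KU by blast
      have "K \<in> sets lebesgue" if "K \<in> E" for K
      proof -
        have "\<exists>u v. K = cbox u v" using D(2)[of K] E(2) that by blast
        then show ?thesis by auto
      qed
      then show "\<Union>E \<in> sets lebesgue" using E(1) by auto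
    qed
    finally show ?thesis .
  qed
  have "f ` U \<subseteq> (\<Union>i. S i)"
  proof safe
    fix x assume "x \<in> U"
    then obtain K where K: "K \<in> \<D>" "x \<in> K" using D(6) by auto
    then obtain i where "K = from_nat_into \<D> i"
      using D(1) from_nat_into_surj by metis
    then show "f x \<in> (\<Union>i. S i)"
      using K \<kappa>(2)[of K] by (auto simp: S_def)
  qed
  then have "measure lebesgue (f ` U) \<le> measure lebesgue (\<Union>i. S i)"
    using fmeasurable_countable_Union[OF S bound] fU by (intro measure_mono_fmeasurable) auto
  also have "\<dots> \<le> M * measure lebesgue U"
    by (rule measure_countable_Union_le[OF S bound])
  finally show ?thesis by (simp add: M_def)
qed simp

context stratified_Lie_group
begin

section \<open>The group identity and derivatives of left translations\<close>

lemma in_carrier [simp]: "x \<in> carrier G"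
  by (simp add: carrier_UNIV)

lemma w_pos: "0 < w i"
  using layers by (metis atLeastAtMost_iff less_le_trans rangeI zero_less_one)

lemma homogeneous_dim_eq_sum: "homogeneous_dim w k = (\<Sum>i\<in>UNIV. w i)"
proof -
  have "(\<Sum>i\<in>UNIV. w i) = (\<Sum>j\<in>{1..k}. \<Sum>i\<in>{i. i \<in> UNIV \<and> w i = j}. w i)"
    using layers by (intro sum.group[symmetric]) auto
  also have "\<dots> = (\<Sum>j=1..k. j * card {i. w i = j})"
    by (intro sum.cong) auto
  finally show ?thesis by (simp add: homogeneous_dim_def)
qed

lemma dilation_mult: "0 < c \<Longrightarrow> dilation w c (x \<otimes> y) = dilation w c x \<otimes> dilation w c y"
  using dilation_automorphism[of c] by (auto simp: iso_def hom_def)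

text \<open>The automorphism \<open>dilation w 2\<close> fixes the identity but multiplies its
  coordinates by \<open>2 ^ w i \<noteq> 1\<close>.\<close>

lemma one_eq_0: "\<one> = 0"
proof -
  have "group_hom G G (dilation w 2)"
    using dilation_automorphism[of 2] is_group
    by (auto simp: group_hom_def group_hom_axioms_def iso_def)
  then have "dilation w 2 \<one> = \<one>"
    by (rule group_hom.hom_one)
  then have "2 ^ w i * \<one> $ i = \<one> $ i" for i
    by (metis dilation_def vec_lambda_beta)
  moreover have "(2::real) ^ w i \<noteq> 1" for i
    using w_pos[of i] by (metis less_irrefl one_less_numeral_iff one_less_power semiring_norm(76))
  ultimately show ?thesis
    by (auto simp: vec_eq_iff)
qed

lemma inv_mult_cancel [simp]: "inv x \<otimes> (x \<otimes> y) = y" "x \<otimes> (inv x \<otimes> y) = y"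
  by (simp_all add: m_assoc[symmetric] one_eq_0[symmetric])

text \<open>Taken from the full derivative of multiplication, so that continuity in \<open>x\<close>
  and \<open>z\<close> jointly is available.\<close>

definition translation_deriv :: "real^'n \<Rightarrow> real^'n \<Rightarrow> real^'n \<Rightarrow> real^'n" where
  "translation_deriv x z v = frechet_derivative (\<lambda>(x, y). x \<otimes> y) (at (x, z)) (0, v)"

lemma mult_differentiable: "(\<lambda>(x, y). x \<otimes> y) differentiable (at p)"
  and continuous_on_mult_deriv:
    "continuous_on UNIV (\<lambda>p. frechet_derivative (\<lambda>(x, y). x \<otimes> y) (at p) v)"
proof -
  have "Ck (Suc 0) (\<lambda>(x, y). x \<otimes> y)"
    using smooth_mult unfolding smooth_def by blast
  then show "(\<lambda>(x, y). x \<otimes> y) differentiable (at p)"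
    "continuous_on UNIV (\<lambda>p. frechet_derivative (\<lambda>(x, y). x \<otimes> y) (at p) v)"
    by (simp_all only: Ck.simps)
qed

lemma continuous_on_mult: "continuous_on UNIV (\<lambda>(x, y). x \<otimes> y)"
  using smooth_mult unfolding smooth_def by (metis Ck.simps(1))

lemma continuous_on_m_inv: "continuous_on UNIV (\<lambda>x. inv x)"
  using smooth_inv unfolding smooth_def by (metis Ck.simps(1))

lemma continuous_on_translation: "continuous_on UNIV (\<lambda>y. x \<otimes> y)"
  using continuous_on_compose2[OF continuous_on_mult, of UNIV "\<lambda>y. (x, y)"]
  by (simp add: continuous_intros)

lemma has_derivative_translation:
  "((\<lambda>y. x \<otimes> y) has_derivative translation_deriv x z) (at z)"
proof -
  have 1: "((\<lambda>(x, y). x \<otimes> y) has_derivative frechet_derivative (\<lambda>(x, y). x \<otimes> y) (at (x, z)))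
      (at (x, z))"
    using mult_differentiable frechet_derivative_works by blast
  have "((\<lambda>y. (x, y)) has_derivative (\<lambda>v. (0, v))) (at z)"
    by (auto intro!: derivative_eq_intros)
  from has_derivative_compose[OF this 1] show ?thesis
    by (simp add: translation_deriv_def[abs_def])
qed

text \<open>The operator norm is at most the sum of the norms of the images of the basis vectors,
  which is continuous in both points and so bounded on a compact product.\<close>

lemma onorm_translation_deriv_bounded:
  assumes "compact A" "compact B"
  shows "\<exists>C\<ge>0. \<forall>x\<in>A. \<forall>z\<in>B. onorm (translation_deriv x z) \<le> C"
proof -
  define h where "h = (\<lambda>p. \<Sum>b\<in>Basis. norm (frechet_derivative (\<lambda>(x, y). x \<otimes> y) (at p) (0, b)))"
  have "continuous_on UNIV h"
    unfolding h_def by (intro continuous_intros continuous_on_mult_deriv)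
  then have "compact (h ` (A \<times> B))"
    using assms by (intro compact_continuous_image compact_Times) (auto intro: continuous_on_subset)
  then obtain C where C: "\<And>p. p \<in> A \<times> B \<Longrightarrow> norm (h p) \<le> C"
    using compact_imp_bounded bounded_iff by (metis imageI)
  have "onorm (translation_deriv x z) \<le> max C 0" if "x \<in> A" "z \<in> B" for x z
  proof -
    have "onorm (translation_deriv x z) \<le> h (x, z)"
      unfolding h_def translation_deriv_def[symmetric]
      by (intro onorm_componentwise has_derivative_bounded_linear[OF has_derivative_translation])
    also have "\<dots> \<le> C" using C[of "(x, z)"] that by simp
    finally show ?thesis by simp
  qed
  then show ?thesis by (meson max.cobounded2)
qed

section \<open>Dilations and dilated balls\<close>

lemma dilation_dilation: "dilation w a (dilation w b x) = dilation w (a * b) x"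
  by (simp add: dilation_def vec_eq_iff power_mult_distrib mult_ac)

lemma dilation_1 [simp]: "dilation w 1 x = x"
  by (simp add: dilation_def vec_eq_iff)

lemma norm_dilation_le:
  assumes "0 \<le> c" "c \<le> 1"
  shows "norm (dilation w c x) \<le> c * norm x"
proof -
  have "norm (dilation w c x) \<le> norm (c *\<^sub>R x)"
  proof (rule norm_le_componentwise_cart)
    fix i
    have "c ^ w i \<le> c ^ 1" using assms w_pos[of i] by (intro power_decreasing) auto
    then show "norm (dilation w c x $ i) \<le> norm ((c *\<^sub>R x) $ i)"
      using assms by (simp add: dilation_def abs_mult mult_right_mono)
  qed
  then show ?thesis using assms by simp
qed

lemma continuous_on_dilation: "continuous_on UNIV (dilation w c)"
  unfolding dilation_def[abs_def] by (intro continuous_intros)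

lemma measure_dilation:
  assumes "S \<in> lmeasurable" "0 < c"
  shows "dilation w c ` S \<in> lmeasurable"
    and "measure lebesgue (dilation w c ` S) = c powr homogeneous_dim w k * measure lebesgue S"
proof -
  have "(\<Prod>i\<in>UNIV. c ^ w i) = c ^ homogeneous_dim w k"
    by (simp add: power_sum homogeneous_dim_eq_sum)
  then show "dilation w c ` S \<in> lmeasurable"
    "measure lebesgue (dilation w c ` S) = c powr homogeneous_dim w k * measure lebesgue S"
    using measurable_stretch[OF assms(1), of "\<lambda>i. c ^ w i"]
      measure_stretch[OF assms(1), of "\<lambda>i. c ^ w i"] assms(2)
    by (simp_all add: dilation_def[abs_def] powr_realpow)
qed

text \<open>A stand-in for the quasi-ball: open, bounded, compatible with dilations, and carried by
  the translation \<open>inv x\<close> to a set of known volume.\<close>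

definition ellipsoid :: "real \<Rightarrow> real^'n \<Rightarrow> real \<Rightarrow> (real^'n) set" where
  "ellipsoid \<rho> x r = (\<lambda>v. x \<otimes> dilation w r v) ` ball 0 \<rho>"

lemma mem_ellipsoid_iff:
  assumes "0 < r"
  shows "y \<in> ellipsoid \<rho> x r \<longleftrightarrow> norm (dilation w (1 / r) (inv x \<otimes> y)) < \<rho>"
proof
  assume "y \<in> ellipsoid \<rho> x r"
  then show "norm (dilation w (1 / r) (inv x \<otimes> y)) < \<rho>"
    using assms by (auto simp: ellipsoid_def dilation_dilation)
next
  assume "norm (dilation w (1 / r) (inv x \<otimes> y)) < \<rho>"
  then show "y \<in> ellipsoid \<rho> x r"
    unfolding ellipsoid_def using assms
    by (intro image_eqI[where x = "dilation w (1 / r) (inv x \<otimes> y)"]) (auto simp: dilation_dilation)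
qed

lemma open_ellipsoid:
  assumes "0 < r"
  shows "open (ellipsoid \<rho> x r)"
proof -
  have "continuous_on UNIV (\<lambda>y. dilation w (1 / r) (inv x \<otimes> y))"
    by (rule continuous_on_compose2[OF continuous_on_dilation continuous_on_translation]) auto
  then have "open {y. norm (dilation w (1 / r) (inv x \<otimes> y)) < \<rho>}"
    by (intro open_Collect_less continuous_intros) auto
  also have "{y. norm (dilation w (1 / r) (inv x \<otimes> y)) < \<rho>} = ellipsoid \<rho> x r"
    using assms by (auto simp: mem_ellipsoid_iff)
  finally show ?thesis .
qed

lemma lmeasurable_ellipsoid:
  assumes "0 < r"
  shows "ellipsoid \<rho> x r \<in> lmeasurable"
proof -
  have "continuous_on UNIV (\<lambda>v. x \<otimes> dilation w r v)"
    by (rule continuous_on_compose2[OF continuous_on_translation continuous_on_dilation]) auto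
  then have "compact ((\<lambda>v. x \<otimes> dilation w r v) ` cball 0 \<rho>)"
    by (intro compact_continuous_image) (auto intro: continuous_on_subset)
  then have "bounded (ellipsoid \<rho> x r)"
    unfolding ellipsoid_def by (rule bounded_subset[OF compact_imp_bounded]) auto
  then show ?thesis using open_ellipsoid[OF assms] by (simp add: lmeasurable_open)
qed

lemma dilation_ellipsoid:
  assumes "0 < a"
  shows "dilation w a ` ellipsoid \<rho> x r = ellipsoid \<rho> (dilation w a x) (a * r)"
  using assms by (simp add: ellipsoid_def image_image dilation_mult dilation_dilation)

text \<open>Translation by \<open>inv x\<close> maps the ellipsoid onto a dilated ball of known
  volume. Its derivative is uniformly bounded on the compact sets involved, so it enlarges volume by
  at most a fixed factor; read backwards, this bounds the ellipsoid from below.\<close>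

lemma measure_small_ellipsoid:
  assumes "0 < \<rho>" "\<rho> \<le> 1"
  shows "\<exists>c>0. \<forall>x r. norm x \<le> 1 \<longrightarrow> 0 < r \<longrightarrow> r \<le> 1 \<longrightarrow>
           c * r powr homogeneous_dim w k \<le> measure lebesgue (ellipsoid \<rho> x r)"
proof -
  \<comment> \<open>\<open>A\<close> contains the translating elements \<open>inv x\<close>, and
    \<open>B\<close> all ellipsoids in question.\<close>
  define A where "A = (\<lambda>x. inv x) ` cball 0 1"
  define B where "B = (\<lambda>(x, y). x \<otimes> y) ` (cball 0 1 \<times> cball 0 1)"
  have "compact A" "compact B"
    unfolding A_def B_def
    by (intro compact_continuous_image compact_Times compact_cball
        continuous_on_subset[OF continuous_on_m_inv] continuous_on_subset[OF continuous_on_mult] subset_UNIV)+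
  then obtain C where C: "0 \<le> C" "\<And>x z. x \<in> A \<Longrightarrow> z \<in> B \<Longrightarrow> onorm (translation_deriv x z) \<le> C"
    using onorm_translation_deriv_bounded[of A B] by blast
  \<comment> \<open>\<open>C + 1\<close> in place of \<open>C\<close> keeps \<open>M\<close>
    positive, since it is divided by.\<close>
  define M where "M = unit_ball_vol DIM(real^'n) * ((C + 1) * DIM(real^'n)) ^ DIM(real^'n)"
  have M: "0 < M" using C by (simp add: M_def)
  define m where "m = measure lebesgue (ball (0::real^'n) \<rho>)"
  have m: "0 < m" using assms by (simp add: m_def content_ball_pos)
  have "m / M * r powr homogeneous_dim w k \<le> measure lebesgue (ellipsoid \<rho> x r)"
    if x: "norm x \<le> 1" and r: "0 < r" "r \<le> 1" for x r
  proof -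
    have img: "(\<lambda>y. inv x \<otimes> y) ` ellipsoid \<rho> x r = dilation w r ` ball 0 \<rho>"
      by (simp add: ellipsoid_def image_image)
    have D: "dilation w r ` ball 0 \<rho> \<in> lmeasurable"
      "measure lebesgue (dilation w r ` ball 0 \<rho>) = r powr homogeneous_dim w k * m"
      using measure_dilation[of "ball 0 \<rho>" r] r by (simp_all add: m_def)
    have sub: "ellipsoid \<rho> x r \<subseteq> B"
    proof
      fix y assume "y \<in> ellipsoid \<rho> x r"
      then obtain v where v: "norm v < \<rho>" "y = x \<otimes> dilation w r v"
        by (auto simp: ellipsoid_def)
      have "norm (dilation w r v) \<le> r * norm v"
        using r by (intro norm_dilation_le) auto
      also have "\<dots> \<le> 1" using r v assms by (intro mult_le_one) auto
      finally have "(x, dilation w r v) \<in> cball 0 1 \<times> cball 0 1" using x by simp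
      then show "y \<in> B" unfolding B_def v by (rule rev_image_eqI) simp
    qed
    have "measure lebesgue ((\<lambda>y. inv x \<otimes> y) ` ellipsoid \<rho> x r) \<le> M * measure lebesgue (ellipsoid \<rho> x r)"
      unfolding M_def
    proof (rule measure_image_le_if_onorm_le)
      show "open (ellipsoid \<rho> x r)" by (rule open_ellipsoid[OF r(1)])
      show "bounded (ellipsoid \<rho> x r)"
        by (rule bounded_subset[OF compact_imp_bounded[OF \<open>compact B\<close>] sub])
      show "((\<lambda>y. inv x \<otimes> y) has_derivative translation_deriv (inv x) y) (at y)" for y
        by (rule has_derivative_translation)
      have "inv x \<in> A" using x by (simp add: A_def)
      then show "onorm (translation_deriv (inv x) y) \<le> C + 1" if "y \<in> ellipsoid \<rho> x r" for y
        using C(2)[of "inv x" y] subsetD[OF sub that] by simp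
      show "0 \<le> C + 1" using C(1) by simp
      show "(\<lambda>y. inv x \<otimes> y) ` ellipsoid \<rho> x r \<in> sets lebesgue"
        unfolding img by (rule fmeasurableD[OF D(1)])
    qed
    then have "r powr homogeneous_dim w k * m / M \<le> measure lebesgue (ellipsoid \<rho> x r)"
      unfolding img D using M by (simp add: pos_divide_le_eq mult.commute)
    then show ?thesis by (simp add: mult.commute)
  qed
  moreover have "0 < m / M" using m M by simp
  ultimately show ?thesis by blast
qed

text \<open>A dilation moves every ellipsoid into the compact region of the previous lemma and
  multiplies both sides of the estimate by the same power.\<close>

lemma measure_ellipsoid:
  assumes "0 < \<rho>" "\<rho> \<le> 1"
  shows "\<exists>c>0. \<forall>x r. 0 < r \<longrightarrow>
           c * r powr homogeneous_dim w k \<le> measure lebesgue (ellipsoid \<rho> x r)"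
proof -
  obtain c where c: "0 < c" "\<And>x r. norm x \<le> 1 \<Longrightarrow> 0 < r \<Longrightarrow> r \<le> 1 \<Longrightarrow>
      c * r powr homogeneous_dim w k \<le> measure lebesgue (ellipsoid \<rho> x r)"
    using measure_small_ellipsoid[OF assms] by blast
  have "c * r powr homogeneous_dim w k \<le> measure lebesgue (ellipsoid \<rho> x r)" if r: "0 < r" for x r
  proof -
    \<comment> \<open>Brings both the centre and the radius into the unit range;
      \<open>a \<le> 1\<close> lets \<open>norm_dilation_le\<close> apply.\<close>
    define a where "a = 1 / (1 + r + norm x)"
    have d: "0 < 1 + r + norm x" using r by (simp add: add_pos_nonneg)
    have a: "0 < a" "a \<le> 1" "a * r \<le> 1" "a * norm x \<le> 1"
      using r d by (auto simp: a_def field_simps)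
    then have "norm (dilation w a x) \<le> 1"
      using norm_dilation_le[of a x] by linarith
    then have "c * (a * r) powr homogeneous_dim w k
        \<le> measure lebesgue (ellipsoid \<rho> (dilation w a x) (a * r))"
      using a r by (intro c) auto
    also have "\<dots> = a powr homogeneous_dim w k * measure lebesgue (ellipsoid \<rho> x r)"
      using a r by (simp add: measure_dilation lmeasurable_ellipsoid flip: dilation_ellipsoid)
    finally have "a powr homogeneous_dim w k * (c * r powr homogeneous_dim w k)
        \<le> a powr homogeneous_dim w k * measure lebesgue (ellipsoid \<rho> x r)"
      using a r by (simp add: powr_mult mult_ac)
    then show ?thesis using a by simp
  qed
  then show ?thesis using c by blast
qed

text \<open>By continuity the quasi-norm is below 1 on a small Euclidean ball; homogeneity and
  symmetry under inversion then place the ellipsoids over that ball inside quasi-balls of the same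
  radius.\<close>

lemma quasi_ball_volume:
  assumes nrm: "homogeneous_quasi_norm G w nrm"
  shows "\<exists>c>0. \<forall>x r. 0 < r \<longrightarrow> (\<exists>S\<in>sets lebesgue. S \<subseteq> quasi_ball G nrm x r \<and>
           ennreal (c * r powr homogeneous_dim w k) \<le> emeasure lebesgue S)"
proof -
  have cont: "continuous_on UNIV nrm" and "nrm 0 = 0"
    using nrm unfolding homogeneous_quasi_norm_def by blast+
  have "open {y. nrm y < 1}"
    by (intro open_Collect_less cont continuous_on_const)
  moreover have "0 \<in> {y. nrm y < 1}"
    using \<open>nrm 0 = 0\<close> by simp
  ultimately obtain \<rho>' where \<rho>': "0 < \<rho>'" "ball 0 \<rho>' \<subseteq> {y. nrm y < 1}"
    by (rule openE)
  define \<rho> where "\<rho> = min \<rho>' 1"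
  have \<rho>: "0 < \<rho>" "\<rho> \<le> 1" "ball 0 \<rho> \<subseteq> {y. nrm y < 1}"
    using \<rho>' by (auto simp: \<rho>_def)
  obtain c where c: "0 < c" "\<And>x r. 0 < r \<Longrightarrow>
      c * r powr homogeneous_dim w k \<le> measure lebesgue (ellipsoid \<rho> x r)"
    using measure_ellipsoid[OF \<rho>(1,2)] by blast
  have "ellipsoid \<rho> x r \<subseteq> quasi_ball G nrm x r" if r: "0 < r" for x r
  proof
    fix y assume "y \<in> ellipsoid \<rho> x r"
    then obtain v where v: "v \<in> ball 0 \<rho>" "y = x \<otimes> dilation w r v"
      unfolding ellipsoid_def by (elim imageE)
    have "inv y \<otimes> x = inv (dilation w r v)"
      by (simp add: v(2) inv_mult_group m_assoc)
    then have "nrm (inv y \<otimes> x) = r * nrm v"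
      using nrm r by (simp add: homogeneous_quasi_norm_def)
    also have "\<dots> < r" using subsetD[OF \<rho>(3) v(1)] r by simp
    finally show "y \<in> quasi_ball G nrm x r"
      by (simp add: quasi_ball_def)
  qed
  moreover have "ennreal (c * r powr homogeneous_dim w k) \<le> emeasure lebesgue (ellipsoid \<rho> x r)"
    if "0 < r" for x r
    unfolding emeasure_eq_measure2[OF lmeasurable_ellipsoid[OF that]]
    by (rule ennreal_leI[OF c(2)[OF that]])
  moreover have "ellipsoid \<rho> x r \<in> sets lebesgue" if "0 < r" for x r
    using lmeasurable_ellipsoid[OF that] by (rule fmeasurableD)
  ultimately have "\<exists>S\<in>sets lebesgue. S \<subseteq> quasi_ball G nrm x r \<and>
      ennreal (c * r powr homogeneous_dim w k) \<le> emeasure lebesgue S" if "0 < r" for x r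
    using that by (intro bexI[of _ "ellipsoid \<rho> x r"] conjI)
  then show ?thesis using c(1) by blast
qed

end

section \<open>The vanishing lemma\<close>

lemma ennreal_root_le_iff:
  assumes "0 < p" "0 \<le> b"
  shows "ennreal_root p a \<le> ennreal b \<longleftrightarrow> a \<le> ennreal (b powr p)"
proof (cases a)
  case (real r)
  have "r powr (1 / p) \<le> b \<longleftrightarrow> r \<le> b powr p"
  proof
    assume "r powr (1 / p) \<le> b"
    then have "(r powr (1 / p)) powr p \<le> b powr p"
      using assms by (intro powr_mono2) auto
    then show "r \<le> b powr p" using assms real by (simp add: powr_powr)
  next
    assume "r \<le> b powr p"
    then have "r powr (1 / p) \<le> (b powr p) powr (1 / p)"
      using assms real by (intro powr_mono2) auto
    then show "r powr (1 / p) \<le> b" using assms by (simp add: powr_powr)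
  qed
  then show ?thesis using real assms by (simp add: ennreal_root_def)
qed (simp add: ennreal_root_def top_unique)

lemma ennreal_root_tendsto_0:
  assumes "(f \<longlongrightarrow> 0) F" "0 < p"
  shows "((\<lambda>x. ennreal_root p (f x)) \<longlongrightarrow> 0) F"
  unfolding tendsto_0_ennreal_iff
proof (intro allI impI)
  fix e :: real assume e: "0 < e"
  then have "\<forall>\<^sub>F x in F. f x \<le> ennreal (e powr p)"
    using assms(1) by (simp add: tendsto_0_ennreal_iff)
  then show "\<forall>\<^sub>F x in F. ennreal_root p (f x) \<le> ennreal e"
    using e assms(2) by (simp add: ennreal_root_le_iff)
qed

lemma (in stratified_Lie_group) lower_regular_kernel_quasi_norm:
  assumes nrm: "homogeneous_quasi_norm G w nrm" and Q: "Q = real (homogeneous_dim w k)" "0 < Q"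
  shows "\<exists>c. lower_regular_kernel lebesgue (\<lambda>x y. nrm (inv y \<otimes> x)) Q c"
proof -
  obtain c where c: "0 < c" "\<forall>x r. 0 < r \<longrightarrow> (\<exists>S\<in>sets lebesgue. S \<subseteq> quasi_ball G nrm x r \<and>
           ennreal (c * r powr Q) \<le> emeasure lebesgue S)"
    using quasi_ball_volume[OF nrm, folded Q(1)] by (elim exE conjE)
  have "continuous_on UNIV (\<lambda>p. inv (snd p))"
    by (rule continuous_on_compose2[OF continuous_on_m_inv continuous_on_snd[OF continuous_on_id]]) simp
  then have "continuous_on UNIV (\<lambda>p. (inv (snd p), fst p))"
    by (intro continuous_on_Pair continuous_on_fst[OF continuous_on_id])
  from continuous_on_compose2[OF continuous_on_mult this]
  have mult: "continuous_on UNIV (\<lambda>p. inv (snd p) \<otimes> fst p)" by simp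
  have "continuous_on UNIV nrm"
    using nrm unfolding homogeneous_quasi_norm_def by blast
  from continuous_on_compose2[OF this mult]
  have "continuous_on UNIV (\<lambda>p. nrm (inv (snd p) \<otimes> fst p))" by simp
  then have 1: "(\<lambda>p. nrm (inv (snd p) \<otimes> fst p)) \<in> borel_measurable (borel \<Otimes>\<^sub>M borel)"
    unfolding borel_prod by (rule borel_measurable_continuous_onI)
  \<comment> \<open>The continuous kernel is Borel on the product; the identity pulls it back to the
    product of the completed measures.\<close>
  have 2: "(\<lambda>p. (fst p, snd p)) \<in> lebesgue \<Otimes>\<^sub>M lebesgue \<rightarrow>\<^sub>M (borel \<Otimes>\<^sub>M borel :: ((real^'n) \<times> (real^'n)) measure)"
    by (intro measurable_Pair measurable_compose[OF measurable_fst] measurable_compose[OF measurable_snd]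
        measurable_completion) simp_all
  have 3: "(\<lambda>(x, y). nrm (inv y \<otimes> x)) \<in> borel_measurable (lebesgue \<Otimes>\<^sub>M lebesgue)"
    using measurable_compose[OF 2 1] by (simp add: case_prod_beta)
  have 4: "x = y" if "nrm (inv y \<otimes> x) = 0" for x y
  proof -
    have "inv y \<otimes> x = \<one>"
      using that nrm by (simp add: homogeneous_quasi_norm_def one_eq_0)
    then have "y \<otimes> (inv y \<otimes> x) = y" by simp
    then show ?thesis by (simp only: inv_mult_cancel)
  qed
  have 5: "\<exists>S\<in>sets lebesgue. (\<forall>y\<in>S. nrm (inv y \<otimes> x) < r) \<and>
      ennreal (c * r powr Q) \<le> emeasure lebesgue S" if "0 < r" for x r
    using c(2)[rule_format, OF that, of x] by (auto simp: quasi_ball_def)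
  have 6: "0 \<le> nrm x" for x
    using nrm by (simp add: homogeneous_quasi_norm_def)
  have "lower_regular_kernel lebesgue (\<lambda>x y. nrm (inv y \<otimes> x)) Q c"
    by (intro lower_regular_kernel.intro lower_regular_kernel_axioms.intro sigma_finite_lebesgue
        3 4 5 6 Q(2) c(1))
  then show ?thesis ..
qed

theorem lemma1p2:
  fixes G :: "(real^'n::finite) monoid" and w :: "'n \<Rightarrow> nat" and k :: nat
    and nrm :: "real^'n \<Rightarrow> real"
    and Q s p q :: real
    and u :: "nat \<Rightarrow> real^'n \<Rightarrow> real"
  assumes "stratified_Lie_group G w k"
    and "homogeneous_quasi_norm G w nrm"
    and "Q = real (homogeneous_dim w k)"
    and "0 < s" and "s < 1" and "1 < p" and "p * s < Q"
    and "p \<le> q" and "q < Q * p / (Q - p * s)"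
    and "\<And>m. u m \<in> W0sp_space G nrm Q s p"
    and "\<exists>M::real. \<forall>m. Wsp_norm G nrm Q s p (u m) \<le> ennreal M"
    and "liminf (\<lambda>m. SUP x. \<integral>\<^sup>+ y \<in> quasi_ball G nrm x 1. ennreal (\<bar>u m y\<bar> powr q) \<partial>lebesgue) = 0"
  shows "\<exists>r::nat \<Rightarrow> nat. strict_mono r \<and>
           (\<forall>t::real. q < t \<and> t < Q * p / (Q - p * s) \<longrightarrow>
              (\<forall>m. u (r m) \<in> Lp_space t) \<and>
              (\<lambda>m. Lp_norm t (u (r m))) \<longlonglongrightarrow> 0)"
proof -
  interpret stratified_Lie_group G w k by fact
  note nrm = assms(2) and Q = assms(3) and s = assms(4,5) and p = assms(6) and q = assms(8,9)
  have pos: "0 < p" "0 < p * s" "p * s < Q" "0 < q"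
    using s p q assms(7) by auto
  define N where "N = (\<lambda>x y. nrm (inv\<^bsub>G\<^esub> y \<otimes>\<^bsub>G\<^esub> x))"
  obtain c where "lower_regular_kernel lebesgue N Q c"
    using lower_regular_kernel_quasi_norm[OF nrm Q] pos unfolding N_def by auto
  then interpret K: lower_regular_kernel lebesgue N Q c .
  have energy: "gagliardo_integral G nrm Q s p v = K.energy p (p * s) v" for v
    unfolding gagliardo_integral_def K.energy_def by (simp add: N_def)
  have u: "u m \<in> borel_measurable lebesgue" "Lp_integral p (u m) < \<infinity>"
    "K.energy p (p * s) (u m) < \<infinity>" for m
    using assms(10)[of m] by (auto simp: W0sp_space_def Wsp_space_def Lp_space_def energy)
  obtain B where "\<And>m. Wsp_norm G nrm Q s p (u m) \<le> ennreal B"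
    using assms(11) by blast
  \<comment> \<open>A negative \<open>B\<close> acts as 0 in \<open>ennreal\<close>;
    \<open>ennreal_root_le_iff\<close> wants a nonnegative real.\<close>
  then have "Wsp_norm G nrm Q s p (u m) \<le> ennreal (max B 0)" for m
    by (rule order_trans) (simp add: ennreal_leI)
  then have sum: "Lp_integral p (u m) + K.energy p (p * s) (u m) \<le> ennreal (max B 0 powr p)" for m
    using pos(1) unfolding Wsp_norm_def energy by (subst ennreal_root_le_iff[symmetric]) simp_all
  have bound: "Lp_integral p (u m) \<le> ennreal (max B 0 powr p)"
    "K.energy p (p * s) (u m) \<le> ennreal (max B 0 powr p)" for m
    by (rule order_trans[OF add_increasing2[OF zero_le order_refl] sum],
        rule order_trans[OF add_increasing[OF zero_le order_refl] sum])
  define X where "X = (\<lambda>m. SUP x. \<integral>\<^sup>+ y \<in> quasi_ball G nrm x 1. ennreal (\<bar>u m y\<bar> powr q) \<partial>lebesgue)"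
  \<comment> \<open>The lower limit is attained along a subsequence; being chosen before
    \<open>t\<close>, it serves all exponents at once.\<close>
  obtain r :: "nat \<Rightarrow> nat" where r: "strict_mono r" "(X \<circ> r) \<longlonglongrightarrow> 0"
    using liminf_subseq_lim[of X] assms(12) by (auto simp: X_def)
  show ?thesis
  proof (intro exI[of _ r] conjI allI impI r(1))
    fix t assume t: "q < t \<and> t < Q * p / (Q - p * s)"
    show "u (r m) \<in> Lp_space t" for m
      using K.subcritical_integral_finite[of "u (r m)" p "p * s" t] u[of "r m"] pos q t
      by (simp add: Lp_space_def Lp_integral_def)
    have "(\<lambda>m. \<integral>\<^sup>+ x. ennreal (\<bar>u (r m) x\<bar> powr t) \<partial>lebesgue) \<longlonglongrightarrow> 0"
    proof (rule K.vanishing[where p = p and \<sigma> = "p * s" and q = q and E = "max B 0 powr p"])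
      show "(\<lambda>m. SUP x\<in>space lebesgue. \<integral>\<^sup>+ y\<in>{y. N x y < 1}. ennreal (\<bar>u (r m) y\<bar> powr q) \<partial>lebesgue)
          \<longlonglongrightarrow> 0"
        using r(2) by (simp add: X_def comp_def quasi_ball_def N_def)
    qed (use bound u pos q t in \<open>auto simp: Lp_integral_def\<close>)
    then show "(\<lambda>m. Lp_norm t (u (r m))) \<longlonglongrightarrow> 0"
      unfolding Lp_norm_def Lp_integral_def using q pos t by (intro ennreal_root_tendsto_0) auto
  qed
qed

end
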